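(* Let $n\ge 1$ and let $X^{\bullet},Y^{\bullet}$ be bounded cochain complexes in $\mathsf{D}^{\mathrm b}(\operatorname{rep}_{\Bbbk}A_n)$. Then $$d_B^D\big(\mathcal B^D(X^{\bullet}),\mathcal B^D(Y^{\bullet})\big)\le d_I^D(X^{\bullet},Y^{\bullet}).$$
   Context: $\Bbbk$ is an algebraically closed field. $A_n$ is the equioriented quiver $1\to 2\to\cdots\to n$ and $\operatorname{rep}_{\Bbbk}A_n$ is the abelian category of its finite-dimensional representations (persistence modules). For $1\le b\le d\le n$, $\mathbb I[b,d]$ is the interval representation ($\Bbbk$ at the vertices $x$ with $b\le x\le d$, identity maps between them, zero elsewhere). Every $M\in\operatorname{rep}_{\Bbbk}A_n$ decomposes uniquely as $M\cong\bigoplus_{b\le d}\mathbb I[b,d]^{m(b,d)}$. Interleavings. For an integer $\delta\ge 0$, the shift $M(\delta)$ is given by $M(\delta)_x=M_{x+\delta}$ if $x+\delta\le n$ and $0$ otherwise, with structure maps those of $M$ (or zero); morphisms are shifted likewise. This is an exact functor. The transition morphism $\phi_M^{\delta}\colon M\to M(\delta)$ is at $x$ the composite structure map $M_x\to M_{x+\delta}$ (zero if $x+\delta>n$). A $\delta$-interleaving pair between $M$ and $N$ is a pair $f\colon M\to N(\delta)$, $g\colon N\to M(\delta)$ with $g(\delta)\circ f=\phi_M^{2\delta}$ and $f(\delta)\circ g=\phi_N^{2\delta}$. Derived interleaving distance. By exactness $(\delta)$ acts termwise on $\mathsf{D}^{\mathrm b}(\operatorname{rep}_{\Bbbk}A_n)$,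 and $H^i(X^\bullet(\delta))=H^i(X^\bullet)(\delta)$. $X^\bullet,Y^\bullet$ are derived $\delta$-interleaved if there are morphisms $f^\bullet\colon X^\bullet\to Y^\bullet(\delta)$, $g^\bullet\colon Y^\bullet\to X^\bullet(\delta)$ in the derived category such that for every $i\in\mathbb Z$, $(H^i(f^\bullet),H^i(g^\bullet))$ is a $\delta$-interleaving pair between $H^i(X^\bullet)$ and $H^i(Y^\bullet)$. $d_I^D(X^\bullet,Y^\bullet)$ is the infimum of the integers $\delta\ge 0$ such that $X^\bullet,Y^\bullet$ are derived $\delta$-interleaved. Barcodes. The barcode $\mathcal B(M)$ is the multiset of intervals $\langle b,d\rangle$ with multiplicity $m(b,d)$. A $\delta$-matching between barcodes $\mathcal B,\mathcal B'$ is a bijection $\sigma$ from a sub-multiset of $\mathcal B$ onto a sub-multiset of $\mathcal B'$ such that all intervals $\langle b,d\rangle$ of $\mathcal B$ or of $\mathcal B'$ with $d-b\ge 2\delta$ are matched, and whenever $\sigma\langle b,d\rangle=\langle b',d'\rangle$ one has $b'-\delta\le b\le d\le d'+\delta$ and $b-\delta\le b'\le d'\le d+\delta$. The derived barcode is $\mathcal B^D(X^\bullet)=\bigsqcup_{i}\mathcal B(H^i(X^\bullet))$ (graded by $i$). $\mathcal B^D(X^\bullet)$ and $\mathcal B^D(Y^\bullet)$ are $\delta$-matched if for every $i$ there is a $\delta$-matching between $\mathcal B(H^i(X^\bullet))$ and $\mathcal B(H^i(Y^\bullet))$. $d_B^D(\mathcal B^D(X^\bullet),\mathcal B^D(Y^\bullet))$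 is the infimum of the integers $\delta\ge 0$ for which they are $\delta$-matched. *)

theory Defs
  imports
    "Jordan_Normal_Form.VS_Connect"
    "HOL-Algebra.AbelCoset"
    "HOL-Library.Multiset"
    "HOL-Library.Extended_Nat"
begin

text \<open>
  Scalars are a type \<open>'k\<close> of class \<open>field\<close> (\<open>alg_closed_field\<close> in the theorem), and vector spaces
  are records \<open>V :: ('k, 'v) module\<close> with \<open>vectorspace class_ring V\<close>. Such a space lives on the set
  \<open>carrier V\<close>, so maps are only meaningful, and only compared, on carriers. The record fields
  \<open>mult\<close> and \<open>one\<close> play no role for modules and are left undefined.
\<close>

subsection \<open>Vector spaces\<close>

definition zero_point :: 'v where
  "zero_point = undefined"

definition zero_space :: "('k, 'v) module" where
  "zero_space = \<lparr>carrier = {zero_point}, mult = undefined, one = undefined,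
     zero = zero_point, add = (\<lambda>_ _. zero_point), smult = (\<lambda>_ _. zero_point)\<rparr>"

text \<open>The elements of \<open>V/W\<close> are the cosets of \<open>W\<close>. Adding \<open>W\<close> to the pointwise multiple
  \<open>a \<odot> C\<close> only matters for \<open>a = 0\<close>.\<close>

definition quot_space :: "('k, 'v) module \<Rightarrow> 'v set \<Rightarrow> ('k, 'v set) module" where
  "quot_space V W = \<lparr>carrier = A_RCOSETS V W, mult = undefined, one = undefined,
     zero = W, add = set_add V, smult = (\<lambda>a C. set_add V W ((\<lambda>v. a \<odot>\<^bsub>V\<^esub> v) ` C))\<rparr>"


subsection \<open>Representations of the equioriented quiver of type A\<close>

text \<open>\<open>arrow M x\<close> is the structure map of the arrow \<open>x \<rightarrow> x + 1\<close>. The fields are constrained only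
  at the vertices \<open>1, \<dots>, n\<close> and at the arrows between them.\<close>

record ('k, 'v) rep =
  space_at :: "nat \<Rightarrow> ('k, 'v) module"
  arrow :: "nat \<Rightarrow> 'v \<Rightarrow> 'v"

definition is_rep :: "nat \<Rightarrow> ('k::field, 'v) rep \<Rightarrow> bool" where
  "is_rep n M \<longleftrightarrow>
     (\<forall>x\<in>{1..n}. vectorspace class_ring (space_at M x) \<and>
                 vectorspace.fin_dim class_ring (space_at M x)) \<and>
     (\<forall>x\<in>{1..<n}. linear_map class_ring (space_at M x) (space_at M (x + 1)) (arrow M x))"

definition rep_mor ::
  "nat \<Rightarrow> ('k::field, 'v) rep \<Rightarrow> ('k, 'w) rep \<Rightarrow> (nat \<Rightarrow> 'v \<Rightarrow> 'w) \<Rightarrow> bool" where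
  "rep_mor n M N f \<longleftrightarrow>
     (\<forall>x\<in>{1..n}. linear_map class_ring (space_at M x) (space_at N x) (f x)) \<and>
     (\<forall>x\<in>{1..<n}. \<forall>v\<in>carrier (space_at M x). f (x + 1) (arrow M x v) = arrow N x (f x v))"

definition rep_iso ::
  "nat \<Rightarrow> ('k::field, 'v) rep \<Rightarrow> ('k, 'w) rep \<Rightarrow> (nat \<Rightarrow> 'v \<Rightarrow> 'w) \<Rightarrow> bool" where
  "rep_iso n M N f \<longleftrightarrow> rep_mor n M N f \<and>
     (\<exists>g. rep_mor n N M g \<and>
        (\<forall>x\<in>{1..n}. (\<forall>v\<in>carrier (space_at M x). g x (f x v) = v) \<and>
                    (\<forall>w\<in>carrier (space_at N x). f x (g x w) = w)))"

definition isomorphic_reps :: "nat \<Rightarrow> ('k::field, 'v) rep \<Rightarrow> ('k, 'w) rep \<Rightarrow> bool" where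
  "isomorphic_reps n M N \<longleftrightarrow> (\<exists>f. rep_iso n M N f)"


subsection \<open>Interval representations and barcodes\<close>

definition interval_rep :: "nat \<Rightarrow> nat \<Rightarrow> ('k::field, 'k) rep" where
  "interval_rep b d = \<lparr>
     space_at = (\<lambda>x. \<lparr>carrier = (if b \<le> x \<and> x \<le> d then UNIV else {0}),
        mult = undefined, one = undefined, zero = 0, add = (+), smult = (*)\<rparr>),
     arrow = (\<lambda>x. if b \<le> x \<and> x + 1 \<le> d then (\<lambda>v. v) else (\<lambda>_. 0))\<rparr>"

text \<open>Direct sum of a family over a finite index set \<open>I\<close>.\<close>

definition rep_sum :: "'i set \<Rightarrow> ('i \<Rightarrow> ('k, 'v) rep) \<Rightarrow> ('k, 'i \<Rightarrow> 'v) rep" where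
  "rep_sum I F = \<lparr>
     space_at = (\<lambda>x. \<lparr>carrier = (\<Pi>\<^sub>E j\<in>I. carrier (space_at (F j) x)),
        mult = undefined, one = undefined,
        zero = (\<lambda>j\<in>I. \<zero>\<^bsub>space_at (F j) x\<^esub>),
        add = (\<lambda>u v. \<lambda>j\<in>I. u j \<oplus>\<^bsub>space_at (F j) x\<^esub> v j),
        smult = (\<lambda>a u. \<lambda>j\<in>I. a \<odot>\<^bsub>space_at (F j) x\<^esub> u j)\<rparr>),
     arrow = (\<lambda>x u. \<lambda>j\<in>I. arrow (F j) x (u j))\<rparr>"

text \<open>The elements of a multiset, with the copies of each element told apart by numbering them.\<close>

definition copies :: "'a multiset \<Rightarrow> ('a \<times> nat) set" where
  "copies B = {(J, j). j < count B J}"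

text \<open>Well defined by the theorem that interval decompositions exist and are unique.\<close>

definition barcode :: "nat \<Rightarrow> ('k::field, 'v) rep \<Rightarrow> (nat \<times> nat) multiset" where
  "barcode n M = (THE B. (\<forall>(b, d)\<in>#B. 1 \<le> b \<and> b \<le> d \<and> d \<le> n) \<and>
     isomorphic_reps n M (rep_sum (copies B) (\<lambda>((b, d), _). interval_rep b d)))"


subsection \<open>Shifts and interleavings\<close>

definition shift :: "nat \<Rightarrow> nat \<Rightarrow> ('k, 'v) rep \<Rightarrow> ('k, 'v) rep" where
  "shift n \<delta> M = \<lparr>
     space_at = (\<lambda>x. if x + \<delta> \<le> n then space_at M (x + \<delta>) else zero_space),
     arrow = (\<lambda>x. if x + 1 + \<delta> \<le> n then arrow M (x + \<delta>) else (\<lambda>_. zero_point))\<rparr>"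

definition shift_mor :: "nat \<Rightarrow> nat \<Rightarrow> (nat \<Rightarrow> 'v \<Rightarrow> 'w) \<Rightarrow> nat \<Rightarrow> 'v \<Rightarrow> 'w" where
  "shift_mor n \<delta> f x = (if x + \<delta> \<le> n then f (x + \<delta>) else (\<lambda>_. zero_point))"

text \<open>The composite \<open>M\<^sub>x \<rightarrow> M\<^bsub>x+k\<^esub>\<close> of the structure maps.\<close>

primrec path_map :: "('k, 'v) rep \<Rightarrow> nat \<Rightarrow> nat \<Rightarrow> 'v \<Rightarrow> 'v" where
  "path_map M x 0 = (\<lambda>v. v)"
| "path_map M x (Suc k) = arrow M (x + k) \<circ> path_map M x k"

definition transition :: "nat \<Rightarrow> nat \<Rightarrow> ('k, 'v) rep \<Rightarrow> nat \<Rightarrow> 'v \<Rightarrow> 'v" where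
  "transition n \<delta> M x = (if x + \<delta> \<le> n then path_map M x \<delta> else (\<lambda>_. zero_point))"

text \<open>\<open>M(\<delta>)(\<delta>)\<close> and \<open>M(2\<delta>)\<close> have equal spaces at every vertex, so that the two sides of the
  equations below can be compared.\<close>

definition interleaving_pair ::
  "nat \<Rightarrow> nat \<Rightarrow> ('k::field, 'v) rep \<Rightarrow> ('k, 'w) rep \<Rightarrow>
   (nat \<Rightarrow> 'v \<Rightarrow> 'w) \<Rightarrow> (nat \<Rightarrow> 'w \<Rightarrow> 'v) \<Rightarrow> bool" where
  "interleaving_pair n \<delta> M N f g \<longleftrightarrow>
     rep_mor n M (shift n \<delta> N) f \<and> rep_mor n N (shift n \<delta> M) g \<and>
     (\<forall>x\<in>{1..n}. \<forall>v\<in>carrier (space_at M x).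
        shift_mor n \<delta> g x (f x v) = transition n (2 * \<delta>) M x v) \<and>
     (\<forall>x\<in>{1..n}. \<forall>w\<in>carrier (space_at N x).
        shift_mor n \<delta> f x (g x w) = transition n (2 * \<delta>) N x w)"


subsection \<open>Bounded complexes and their cohomology\<close>

record ('k, 'v) cpx =
  cobj :: "int \<Rightarrow> ('k, 'v) rep"
  cdiff :: "int \<Rightarrow> nat \<Rightarrow> 'v \<Rightarrow> 'v"

definition is_complex :: "nat \<Rightarrow> ('k::field, 'v) cpx \<Rightarrow> bool" where
  "is_complex n X \<longleftrightarrow>
     (\<forall>i. is_rep n (cobj X i)) \<and>
     (\<forall>i. rep_mor n (cobj X i) (cobj X (i + 1)) (cdiff X i)) \<and>
     (\<forall>i. \<forall>x\<in>{1..n}. \<forall>v\<in>carrier (space_at (cobj X i) x).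
        cdiff X (i + 1) x (cdiff X i x v) = \<zero>\<^bsub>space_at (cobj X (i + 2)) x\<^esub>)"

definition bounded_complex :: "nat \<Rightarrow> ('k::field, 'v) cpx \<Rightarrow> bool" where
  "bounded_complex n X \<longleftrightarrow> is_complex n X \<and>
     (\<exists>a b. \<forall>i. i < a \<or> b < i \<longrightarrow>
        (\<forall>x\<in>{1..n}. carrier (space_at (cobj X i) x) = {\<zero>\<^bsub>space_at (cobj X i) x\<^esub>}))"

definition chain_map ::
  "nat \<Rightarrow> ('k::field, 'v) cpx \<Rightarrow> ('k, 'w) cpx \<Rightarrow> (int \<Rightarrow> nat \<Rightarrow> 'v \<Rightarrow> 'w) \<Rightarrow> bool" where
  "chain_map n X Y f \<longleftrightarrow>
     (\<forall>i. rep_mor n (cobj X i) (cobj Y i) (f i)) \<and>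
     (\<forall>i. \<forall>x\<in>{1..n}. \<forall>v\<in>carrier (space_at (cobj X i) x).
        f (i + 1) x (cdiff X i x v) = cdiff Y i x (f i x v))"

definition homotopic ::
  "nat \<Rightarrow> ('k::field, 'v) cpx \<Rightarrow> ('k, 'w) cpx \<Rightarrow>
   (int \<Rightarrow> nat \<Rightarrow> 'v \<Rightarrow> 'w) \<Rightarrow> (int \<Rightarrow> nat \<Rightarrow> 'v \<Rightarrow> 'w) \<Rightarrow> bool" where
  "homotopic n X Y f g \<longleftrightarrow>
     (\<exists>h. (\<forall>i. rep_mor n (cobj X i) (cobj Y (i - 1)) (h i)) \<and>
        (\<forall>i. \<forall>x\<in>{1..n}. \<forall>v\<in>carrier (space_at (cobj X i) x).
           f i x v = g i x v \<oplus>\<^bsub>space_at (cobj Y i) x\<^esub>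
             (cdiff Y (i - 1) x (h i x v) \<oplus>\<^bsub>space_at (cobj Y i) x\<^esub> h (i + 1) x (cdiff X i x v))))"

definition cocycles :: "('k, 'v) cpx \<Rightarrow> int \<Rightarrow> nat \<Rightarrow> 'v set" where
  "cocycles X i x =
     {v \<in> carrier (space_at (cobj X i) x). cdiff X i x v = \<zero>\<^bsub>space_at (cobj X (i + 1)) x\<^esub>}"

definition coboundaries :: "('k, 'v) cpx \<Rightarrow> int \<Rightarrow> nat \<Rightarrow> 'v set" where
  "coboundaries X i x = cdiff X (i - 1) x ` carrier (space_at (cobj X (i - 1)) x)"

text \<open>In the next two definitions a map \<open>g\<close> is induced on cosets by \<open>v + B \<mapsto> g v + B'\<close>, where
  \<open>g v + B'\<close> is obtained as the sum \<open>B' + g(v + B)\<close>.\<close>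

definition cohomology :: "('k, 'v) cpx \<Rightarrow> int \<Rightarrow> ('k, 'v set) rep" where
  "cohomology X i = \<lparr>
     space_at = (\<lambda>x. quot_space ((space_at (cobj X i) x)\<lparr>carrier := cocycles X i x\<rparr>)
                                (coboundaries X i x)),
     arrow = (\<lambda>x C. set_add (space_at (cobj X i) (x + 1))
                            (coboundaries X i (x + 1)) (arrow (cobj X i) x ` C))\<rparr>"

definition coh_map ::
  "('k, 'w) cpx \<Rightarrow> (int \<Rightarrow> nat \<Rightarrow> 'v \<Rightarrow> 'w) \<Rightarrow> int \<Rightarrow> nat \<Rightarrow> 'v set \<Rightarrow> 'w set" where
  "coh_map Y f i x C = set_add (space_at (cobj Y i) x) (coboundaries Y i x) (f i x ` C)"

definition quasi_iso ::
  "nat \<Rightarrow> ('k::field, 'v) cpx \<Rightarrow> ('k, 'w) cpx \<Rightarrow> (int \<Rightarrow> nat \<Rightarrow> 'v \<Rightarrow> 'w) \<Rightarrow> bool" where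
  "quasi_iso n X Y s \<longleftrightarrow> chain_map n X Y s \<and>
     (\<forall>i. rep_iso n (cohomology X i) (cohomology Y i) (coh_map Y s i))"


subsection \<open>The bounded derived category\<close>

text \<open>
  The bounded derived category is the localisation of the bounded homotopy category at the
  quasi-isomorphisms: a morphism \<open>X \<rightarrow> Y\<close> is a class of roofs \<open>X \<leftarrow> Z \<rightarrow> Y\<close>, the left leg being a
  quasi-isomorphism. The spaces of the apex \<open>Z\<close> live on the type \<open>'k vec\<close>, which contains all
  coordinate spaces \<open>k\<^sup>d\<close>; every bounded complex is isomorphic to one of this kind, so that no
  roof is lost.
\<close>

type_synonym ('k, 'v, 'w) roof =
  "('k, 'k vec) cpx \<times> (int \<Rightarrow> nat \<Rightarrow> 'k vec \<Rightarrow> 'v) \<times> (int \<Rightarrow> nat \<Rightarrow> 'k vec \<Rightarrow> 'w)"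

definition roofs ::
  "nat \<Rightarrow> ('k::field, 'v) cpx \<Rightarrow> ('k, 'w) cpx \<Rightarrow> ('k, 'v, 'w) roof set" where
  "roofs n X Y = {(Z, s, f). bounded_complex n Z \<and> quasi_iso n Z X s \<and> chain_map n Z Y f}"

definition roof_equiv ::
  "nat \<Rightarrow> ('k::field, 'v) cpx \<Rightarrow> ('k, 'w) cpx \<Rightarrow> (('k, 'v, 'w) roof \<times> ('k, 'v, 'w) roof) set" where
  "roof_equiv n X Y = {((Z, s, f), (Z', s', f')).
     (Z, s, f) \<in> roofs n X Y \<and> (Z', s', f') \<in> roofs n X Y \<and>
     (\<exists>(W :: ('k, 'k vec) cpx) u u'. bounded_complex n W \<and>
        chain_map n W Z u \<and> chain_map n W Z' u' \<and>
        quasi_iso n W X (\<lambda>i x. s i x \<circ> u i x) \<and>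
        homotopic n W X (\<lambda>i x. s i x \<circ> u i x) (\<lambda>i x. s' i x \<circ> u' i x) \<and>
        homotopic n W Y (\<lambda>i x. f i x \<circ> u i x) (\<lambda>i x. f' i x \<circ> u' i x))}"

definition derived_hom ::
  "nat \<Rightarrow> ('k::field, 'v) cpx \<Rightarrow> ('k, 'w) cpx \<Rightarrow> ('k, 'v, 'w) roof set set" where
  "derived_hom n X Y = roofs n X Y // roof_equiv n X Y"

text \<open>\<open>H\<^sup>i\<close> of the class of \<open>X \<leftarrow> Z \<rightarrow> Y\<close>, with legs \<open>s\<close> and \<open>f\<close>, is \<open>H\<^sup>i(f) \<circ> H\<^sup>i(s)\<^sup>-\<^sup>1\<close>; on the
  spaces of \<open>H\<^sup>i(X)\<close> this does not depend on the chosen representative.\<close>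

definition derived_coh_map ::
  "('k, 'v) cpx \<Rightarrow> ('k, 'w) cpx \<Rightarrow> ('k, 'v, 'w) roof set \<Rightarrow> int \<Rightarrow> nat \<Rightarrow> 'v set \<Rightarrow> 'w set" where
  "derived_coh_map X Y \<phi> i x =
     (case (SOME r. r \<in> \<phi>) of (Z, s, f) \<Rightarrow>
        coh_map Y f i x \<circ> inv_into (carrier (space_at (cohomology Z i) x)) (coh_map X s i x))"


subsection \<open>The derived interleaving distance\<close>

definition cpx_shift :: "nat \<Rightarrow> nat \<Rightarrow> ('k, 'v) cpx \<Rightarrow> ('k, 'v) cpx" where
  "cpx_shift n \<delta> X = \<lparr>cobj = (\<lambda>i. shift n \<delta> (cobj X i)), cdiff = (\<lambda>i. shift_mor n \<delta> (cdiff X i))\<rparr>"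

text \<open>
  The identification \<open>H\<^sup>i(X(\<delta>)) = H\<^sup>i(X)(\<delta>)\<close>. For \<open>x + \<delta> \<le> n\<close> both sides have literally the same
  space at \<open>x\<close>; for \<open>x + \<delta> > n\<close> both are zero spaces, but with different zero elements
  (\<open>{zero_point}\<close> and \<open>zero_point\<close>).
\<close>

definition coh_shift_iso :: "nat \<Rightarrow> nat \<Rightarrow> nat \<Rightarrow> 'v set \<Rightarrow> 'v set" where
  "coh_shift_iso n \<delta> x = (if x + \<delta> \<le> n then (\<lambda>C. C) else (\<lambda>_. zero_point))"

lemma space_at_cohomology_cpx_shift:
  assumes "x + \<delta> \<le> n"
  shows "space_at (cohomology (cpx_shift n \<delta> X) i) x = space_at (shift n \<delta> (cohomology X i)) x"
  using assms
  by (simp add: cohomology_def cpx_shift_def shift_def shift_mor_def cocycles_def coboundaries_def)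

lemma arrow_cohomology_cpx_shift:
  assumes "x + 1 + \<delta> \<le> n"
  shows "arrow (cohomology (cpx_shift n \<delta> X) i) x = arrow (shift n \<delta> (cohomology X i)) x"
  using assms
  by (simp add: cohomology_def cpx_shift_def shift_def shift_mor_def coboundaries_def)

lemma carrier_cohomology_cpx_shift_zero:
  assumes "n < x + \<delta>"
  shows "carrier (space_at (cohomology (cpx_shift n \<delta> X) i) x) = {{zero_point}}"
  using assms
  by (auto simp: cohomology_def cpx_shift_def shift_def shift_mor_def cocycles_def coboundaries_def
      quot_space_def zero_space_def A_RCOSETS_def RCOSETS_def r_coset_def)

definition derived_interleaved ::
  "nat \<Rightarrow> nat \<Rightarrow> ('k::field, 'v) cpx \<Rightarrow> ('k, 'w) cpx \<Rightarrow> bool" where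
  "derived_interleaved n \<delta> X Y \<longleftrightarrow>
     (\<exists>\<phi>\<in>derived_hom n X (cpx_shift n \<delta> Y). \<exists>\<psi>\<in>derived_hom n Y (cpx_shift n \<delta> X).
        \<forall>i. interleaving_pair n \<delta> (cohomology X i) (cohomology Y i)
          (\<lambda>x. coh_shift_iso n \<delta> x \<circ> derived_coh_map X (cpx_shift n \<delta> Y) \<phi> i x)
          (\<lambda>x. coh_shift_iso n \<delta> x \<circ> derived_coh_map Y (cpx_shift n \<delta> X) \<psi> i x))"

definition derived_interleaving_dist ::
  "nat \<Rightarrow> ('k::field, 'v) cpx \<Rightarrow> ('k, 'w) cpx \<Rightarrow> enat" where
  "derived_interleaving_dist n X Y = (INF \<delta>\<in>{\<delta>. derived_interleaved n \<delta> X Y}. enat \<delta>)"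


subsection \<open>The derived bottleneck distance\<close>

text \<open>Inequalities such as \<open>b' - \<delta> \<le> b\<close> are written without subtraction, as \<open>b' \<le> b + \<delta>\<close>.\<close>

definition delta_matching ::
  "nat \<Rightarrow> (nat \<times> nat) multiset \<Rightarrow> (nat \<times> nat) multiset \<Rightarrow>
   ((nat \<times> nat) \<times> nat) set \<Rightarrow> ((nat \<times> nat) \<times> nat) set \<Rightarrow>
   ((nat \<times> nat) \<times> nat \<Rightarrow> (nat \<times> nat) \<times> nat) \<Rightarrow> bool" where
  "delta_matching \<delta> B B' S S' \<sigma> \<longleftrightarrow>
     S \<subseteq> copies B \<and> S' \<subseteq> copies B' \<and> bij_betw \<sigma> S S' \<and>
     (\<forall>((b, d), j)\<in>copies B. b + 2 * \<delta> \<le> d \<longrightarrow> ((b, d), j) \<in> S) \<and>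
     (\<forall>((b, d), j)\<in>copies B'. b + 2 * \<delta> \<le> d \<longrightarrow> ((b, d), j) \<in> S') \<and>
     (\<forall>b d j b' d' j'. ((b, d), j) \<in> S \<and> \<sigma> ((b, d), j) = ((b', d'), j') \<longrightarrow>
        b' \<le> b + \<delta> \<and> b \<le> d \<and> d \<le> d' + \<delta> \<and>
        b \<le> b' + \<delta> \<and> b' \<le> d' \<and> d' \<le> d + \<delta>)"

definition derived_barcode ::
  "nat \<Rightarrow> ('k::field, 'v) cpx \<Rightarrow> int \<Rightarrow> (nat \<times> nat) multiset" where
  "derived_barcode n X i = barcode n (cohomology X i)"

definition derived_matched ::
  "nat \<Rightarrow> (int \<Rightarrow> (nat \<times> nat) multiset) \<Rightarrow> (int \<Rightarrow> (nat \<times> nat) multiset) \<Rightarrow> bool" where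
  "derived_matched \<delta> \<B> \<B>' \<longleftrightarrow> (\<forall>i. \<exists>S S' \<sigma>. delta_matching \<delta> (\<B> i) (\<B>' i) S S' \<sigma>)"

definition derived_bottleneck_dist ::
  "(int \<Rightarrow> (nat \<times> nat) multiset) \<Rightarrow> (int \<Rightarrow> (nat \<times> nat) multiset) \<Rightarrow> enat" where
  "derived_bottleneck_dist \<B> \<B>' = (INF \<delta>\<in>{\<delta>. derived_matched \<delta> \<B> \<B>'}. enat \<delta>)"

end

theory Submission
  imports Defs
begin

text \<open>
Cohomology sees a derived interleaving only through the interleaving pairs that it induces on the
representations \<open>H\<^sup>i(X)\<close> and \<open>H\<^sup>i(Y)\<close>. So the inequality follows degree by degree from the
algebraic stability theorem: a \<open>\<delta>\<close>-interleaving \<open>f, g\<close> of two representations \<open>M, N\<close> yields a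
\<open>\<delta>\<close>-matching of their barcodes (\<open>algebraic_stability\<close>). That the cohomology of a complex is again
a representation is \<open>cohomology_is_rep\<close>.

The proof of stability follows the induced matchings of Bauer and Lesnick, but on the level of rank
functions. The image \<open>I\<close> of \<open>f: M \<rightarrow> N(\<delta>)\<close> is a quotient of \<open>M\<close> and a submodule of \<open>N(\<delta>)\<close>. A
quotient map keeps births and shortens lifetimes, so the bars of \<open>I\<close> should inject into those of
\<open>M\<close> with the same birth; dually they should inject into those of \<open>N(\<delta>)\<close> with the same death. Since
\<open>g\<close> recovers \<open>M\<close> and \<open>N\<close> up to a shift by \<open>2\<delta>\<close>, no bar loses more than \<open>2\<delta>\<close> of its length, and
no bar of length at least \<open>2\<delta>\<close> disappears. Composing the two injections matches \<open>M\<close> with \<open>N\<close>.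

All that is needed about \<open>I\<close> is its rank function \<open>r(b, d)\<close>, the rank of the composite
\<open>M\<^sub>b \<rightarrow> M\<^sub>d \<rightarrow> N\<^bsub>d+\<delta>\<^esub>\<close>. Every comparison of bar counts, and also the fact that inclusion-exclusion
on \<open>r\<close> gives nonnegative multiplicities, is an instance of the inequality
\<open>dim T(Q) + dim P \<le> dim Q + dim T(P)\<close> for subspaces \<open>P \<subseteq> Q\<close> (\<open>frobenius_inequality\<close>). The counts
determine the injections: sort the bars with a common birth (or death) by length and pair them in
that order (\<open>matching_from_counts\<close>).

Two further facts connect ranks with barcodes. An interval decomposition exists
(\<open>exists_bar_coordinates\<close>): a longest-lived vector among those born first spans an interval
summand, and induction on the total dimension applies to a complement. For any decomposition, the
rank of \<open>M\<^sub>b \<rightarrow> M\<^sub>d\<close> is the number of bars that contain \<open>b\<close> and \<open>d\<close> (\<open>dim_image_at\<close>); in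
particular the decomposition is unique, so that \<open>barcode\<close> is what it should be
(\<open>barcode_correct\<close>).
\<close>

section \<open>Finite-dimensional vector spaces\<close>

abbreviation vspace :: "('k::field, 'v) module \<Rightarrow> bool" where
  "vspace V \<equiv> vectorspace class_ring V"

abbreviation vdim :: "('k::field, 'v) module \<Rightarrow> nat" where
  "vdim V \<equiv> vectorspace.dim class_ring V"

abbreviation lin :: "('k::field, 'v) module \<Rightarrow> ('k, 'w) module \<Rightarrow> ('v \<Rightarrow> 'w) \<Rightarrow> bool" where
  "lin V W T \<equiv> linear_map class_ring V W T"

definition fd_space :: "('k::field, 'v) module \<Rightarrow> bool" where
  "fd_space V \<longleftrightarrow> vspace V \<and> vectorspace.fin_dim class_ring V"

abbreviation restr :: "('k, 'v) module \<Rightarrow> 'v set \<Rightarrow> ('k, 'v) module" where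
  "restr V U \<equiv> V\<lparr>carrier := U\<rparr>"

definition subsp :: "('k, 'v) module \<Rightarrow> 'v set \<Rightarrow> bool" where
  "subsp V U \<longleftrightarrow> U \<subseteq> carrier V \<and> \<zero>\<^bsub>V\<^esub> \<in> U \<and> (\<forall>u\<in>U. \<forall>v\<in>U. u \<oplus>\<^bsub>V\<^esub> v \<in> U) \<and> (\<forall>a. \<forall>u\<in>U. a \<odot>\<^bsub>V\<^esub> u \<in> U)"

definition functional :: "('k::field, 'v) module \<Rightarrow> ('v \<Rightarrow> 'k) \<Rightarrow> bool" where
  "functional V l \<longleftrightarrow> (\<forall>u\<in>carrier V. \<forall>v\<in>carrier V. l (u \<oplus>\<^bsub>V\<^esub> v) = l u + l v) \<and>
     (\<forall>a. \<forall>u\<in>carrier V. l (a \<odot>\<^bsub>V\<^esub> u) = a * l u)"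

lemma class_ring_field: "Ring.field (class_ring :: 'k::field ring)"
  by (fact class_field.field_axioms)

lemma vspace_simps:
  assumes "vspace V"
  shows "\<zero>\<^bsub>V\<^esub> \<in> carrier V"
    "\<lbrakk>u \<in> carrier V; v \<in> carrier V\<rbrakk> \<Longrightarrow> u \<oplus>\<^bsub>V\<^esub> v \<in> carrier V"
    "u \<in> carrier V \<Longrightarrow> a \<odot>\<^bsub>V\<^esub> u \<in> carrier V"
    "u \<in> carrier V \<Longrightarrow> \<zero>\<^bsub>V\<^esub> \<oplus>\<^bsub>V\<^esub> u = u"
    "u \<in> carrier V \<Longrightarrow> u \<oplus>\<^bsub>V\<^esub> \<zero>\<^bsub>V\<^esub> = u"
    "u \<in> carrier V \<Longrightarrow> 0 \<odot>\<^bsub>V\<^esub> u = \<zero>\<^bsub>V\<^esub>"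
    "u \<in> carrier V \<Longrightarrow> 1 \<odot>\<^bsub>V\<^esub> u = u"
    "a \<odot>\<^bsub>V\<^esub> \<zero>\<^bsub>V\<^esub> = \<zero>\<^bsub>V\<^esub>"
proof -
  interpret vectorspace class_ring V by fact
  show "\<zero>\<^bsub>V\<^esub> \<in> carrier V"
    "\<lbrakk>u \<in> carrier V; v \<in> carrier V\<rbrakk> \<Longrightarrow> u \<oplus>\<^bsub>V\<^esub> v \<in> carrier V"
    "u \<in> carrier V \<Longrightarrow> a \<odot>\<^bsub>V\<^esub> u \<in> carrier V"
    "u \<in> carrier V \<Longrightarrow> \<zero>\<^bsub>V\<^esub> \<oplus>\<^bsub>V\<^esub> u = u"
    "u \<in> carrier V \<Longrightarrow> u \<oplus>\<^bsub>V\<^esub> \<zero>\<^bsub>V\<^esub> = u" by auto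
  show "u \<in> carrier V \<Longrightarrow> 0 \<odot>\<^bsub>V\<^esub> u = \<zero>\<^bsub>V\<^esub>" using lmult_0[of u] by simp
  show "u \<in> carrier V \<Longrightarrow> 1 \<odot>\<^bsub>V\<^esub> u = u" using smult_one[of u] by simp
  show "a \<odot>\<^bsub>V\<^esub> \<zero>\<^bsub>V\<^esub> = \<zero>\<^bsub>V\<^esub>" using rmult_0[of a] by simp
qed

lemma vspace_ac:
  assumes "vspace V" "u \<in> carrier V" "v \<in> carrier V" "w \<in> carrier V"
  shows "(u \<oplus>\<^bsub>V\<^esub> v) \<oplus>\<^bsub>V\<^esub> w = u \<oplus>\<^bsub>V\<^esub> (v \<oplus>\<^bsub>V\<^esub> w)" "u \<oplus>\<^bsub>V\<^esub> (v \<oplus>\<^bsub>V\<^esub> w) = v \<oplus>\<^bsub>V\<^esub> (u \<oplus>\<^bsub>V\<^esub> w)"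
    "u \<oplus>\<^bsub>V\<^esub> v = v \<oplus>\<^bsub>V\<^esub> u"
proof -
  interpret vectorspace class_ring V by fact
  show "(u \<oplus>\<^bsub>V\<^esub> v) \<oplus>\<^bsub>V\<^esub> w = u \<oplus>\<^bsub>V\<^esub> (v \<oplus>\<^bsub>V\<^esub> w)" "u \<oplus>\<^bsub>V\<^esub> (v \<oplus>\<^bsub>V\<^esub> w) = v \<oplus>\<^bsub>V\<^esub> (u \<oplus>\<^bsub>V\<^esub> w)"
    "u \<oplus>\<^bsub>V\<^esub> v = v \<oplus>\<^bsub>V\<^esub> u"
    using assms by (auto simp: M.a_ac)
qed

lemma vspace_distrib:
  assumes "vspace V" "u \<in> carrier V"
  shows "v \<in> carrier V \<Longrightarrow> a \<odot>\<^bsub>V\<^esub> (u \<oplus>\<^bsub>V\<^esub> v) = a \<odot>\<^bsub>V\<^esub> u \<oplus>\<^bsub>V\<^esub> a \<odot>\<^bsub>V\<^esub> v"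
    "(a + b) \<odot>\<^bsub>V\<^esub> u = a \<odot>\<^bsub>V\<^esub> u \<oplus>\<^bsub>V\<^esub> b \<odot>\<^bsub>V\<^esub> u"
    "(a * b) \<odot>\<^bsub>V\<^esub> u = a \<odot>\<^bsub>V\<^esub> (b \<odot>\<^bsub>V\<^esub> u)"
    "u \<oplus>\<^bsub>V\<^esub> (-1) \<odot>\<^bsub>V\<^esub> u = \<zero>\<^bsub>V\<^esub>"
proof -
  interpret vectorspace class_ring V by fact
  show "v \<in> carrier V \<Longrightarrow> a \<odot>\<^bsub>V\<^esub> (u \<oplus>\<^bsub>V\<^esub> v) = a \<odot>\<^bsub>V\<^esub> u \<oplus>\<^bsub>V\<^esub> a \<odot>\<^bsub>V\<^esub> v"
    using assms by (simp add: smult_r_distr)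
  show *: "(a + b) \<odot>\<^bsub>V\<^esub> u = a \<odot>\<^bsub>V\<^esub> u \<oplus>\<^bsub>V\<^esub> b \<odot>\<^bsub>V\<^esub> u" for a b
    using smult_l_distr[of a b u] assms by simp
  show "(a * b) \<odot>\<^bsub>V\<^esub> u = a \<odot>\<^bsub>V\<^esub> (b \<odot>\<^bsub>V\<^esub> u)"
    using smult_assoc1[of a b u] assms by simp
  show "u \<oplus>\<^bsub>V\<^esub> (-1) \<odot>\<^bsub>V\<^esub> u = \<zero>\<^bsub>V\<^esub>"
    using *[of 1 "-1"] vspace_simps(6,7)[OF assms] by simp
qed

lemma linI:
  assumes "vspace V" "vspace W" "\<And>v. v \<in> carrier V \<Longrightarrow> T v \<in> carrier W"
    "\<And>u v. u \<in> carrier V \<Longrightarrow> v \<in> carrier V \<Longrightarrow> T (u \<oplus>\<^bsub>V\<^esub> v) = T u \<oplus>\<^bsub>W\<^esub> T v"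
    "\<And>a u. u \<in> carrier V \<Longrightarrow> T (a \<odot>\<^bsub>V\<^esub> u) = a \<odot>\<^bsub>W\<^esub> T u"
  shows "lin V W T"
  unfolding linear_map_def mod_hom_def mod_hom_axioms_def LinearCombinations.module_hom_def
proof (intro conjI)
  show "Module.module class_ring V" "Module.module class_ring W"
    using assms(1,2) by (simp_all add: vectorspace_def)
  show "T \<in> {f. f \<in> carrier V \<rightarrow> carrier W \<and>
      (\<forall>u v. u \<in> carrier V \<and> v \<in> carrier V \<longrightarrow> f (u \<oplus>\<^bsub>V\<^esub> v) = f u \<oplus>\<^bsub>W\<^esub> f v) \<and>
      (\<forall>a u. a \<in> carrier class_ring \<and> u \<in> carrier V \<longrightarrow> f (a \<odot>\<^bsub>V\<^esub> u) = a \<odot>\<^bsub>W\<^esub> f u)}"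
    using assms(3-5) by blast
qed (fact assms)+

lemma linD:
  assumes "lin V W T"
  shows "vspace V" "vspace W" "\<And>v. v \<in> carrier V \<Longrightarrow> T v \<in> carrier W"
    "\<And>u v. u \<in> carrier V \<Longrightarrow> v \<in> carrier V \<Longrightarrow> T (u \<oplus>\<^bsub>V\<^esub> v) = T u \<oplus>\<^bsub>W\<^esub> T v"
    "\<And>a u. u \<in> carrier V \<Longrightarrow> T (a \<odot>\<^bsub>V\<^esub> u) = a \<odot>\<^bsub>W\<^esub> T u"
    "T \<zero>\<^bsub>V\<^esub> = \<zero>\<^bsub>W\<^esub>"
proof -
  show "T \<zero>\<^bsub>V\<^esub> = \<zero>\<^bsub>W\<^esub>" using assms unfolding linear_map_def by (intro mod_hom.f0_is_0) auto
qed (use assms in \<open>auto simp: linear_map_def mod_hom_def mod_hom_axioms_def LinearCombinations.module_hom_def\<close>)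

lemma subspD:
  assumes "subsp V U"
  shows "U \<subseteq> carrier V" "\<zero>\<^bsub>V\<^esub> \<in> U" "\<And>u v. u \<in> U \<Longrightarrow> v \<in> U \<Longrightarrow> u \<oplus>\<^bsub>V\<^esub> v \<in> U"
     "\<And>a u. u \<in> U \<Longrightarrow> a \<odot>\<^bsub>V\<^esub> u \<in> U" "\<And>u. u \<in> U \<Longrightarrow> u \<in> carrier V"
  using assms by (auto simp: subsp_def)

lemma subsp_submodule:
  assumes "vspace V" "subsp V U"
  shows "submodule class_ring U V"
  using assms unfolding submodule_def subsp_def vectorspace_def by auto

lemma restr_vspace:
  assumes "vspace V" "subsp V U"
  shows "vspace (restr V U)"
  using module.submodule_is_module[OF _ subsp_submodule[OF assms]] assms(1)
  by (auto simp: vectorspace_def)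

lemma subsp_carrier: "vspace V \<Longrightarrow> subsp V (carrier V)"
  by (simp add: subsp_def vspace_simps)

text \<open>
A linearly independent subset of \<open>U\<close> is independent in \<open>V\<close>, so its size is bounded by \<open>dim V\<close>; a
maximal one is a finite basis of \<open>U\<close>.
\<close>

lemma subsp_fin_dim:
  assumes V: "fd_space V" and U: "subsp V U"
  shows "fd_space (restr V U)"
proof -
  have vs: "vspace V" and fd: "vectorspace.fin_dim class_ring V"
    using V by (auto simp: fd_space_def)
  interpret V: vectorspace class_ring V by fact
  interpret U: vectorspace class_ring "restr V U" by (rule restr_vspace[OF vs U])
  have sm: "submodule class_ring U V" by (rule subsp_submodule[OF vs U])
  have "\<exists>A. finite A \<and> maximal A (\<lambda>S. S \<subseteq> carrier (restr V U) \<and> U.lin_indpt S)"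
  proof (rule maximal_exists[where B = "{}" and N = V.dim])
    fix A assume A: "A \<subseteq> carrier (restr V U) \<and> U.lin_indpt A"
    hence "V.lin_indpt A" using V.span_li_not_depend(2)[OF _ sm, of A] by simp
    moreover have "A \<subseteq> carrier V" using A subspD(1)[OF U] by auto
    ultimately show "finite A \<and> card A \<le> V.dim" using V.li_le_dim[OF fd] by blast
  qed (auto simp: U.lin_dep_def)
  then obtain A where A: "finite A" "U.basis A" using U.max_li_is_basis by blast
  hence "U.fin_dim" unfolding U.fin_dim_def U.basis_def by blast
  thus ?thesis using U.vectorspace_axioms unfolding fd_space_def by blast
qed

lemma subsp_dim_le:
  assumes V: "fd_space V" and U: "subsp V U"
  shows "vdim (restr V U) \<le> vdim V"
proof -
  have vs: "vspace V" and fd: "vectorspace.fin_dim class_ring V"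
    using V by (auto simp: fd_space_def)
  interpret V: vectorspace class_ring V by fact
  interpret U: vectorspace class_ring "restr V U" by (rule restr_vspace[OF vs U])
  have "U.fin_dim" using subsp_fin_dim[OF assms] by (simp add: fd_space_def)
  then obtain A where A: "finite A" "U.basis A" using U.finite_basis_exists by blast
  have AU: "A \<subseteq> U" "U.lin_indpt A" using A by (auto simp: U.basis_def)
  have "V.lin_indpt A" using V.span_li_not_depend(2)[OF AU(1) subsp_submodule[OF vs U]] AU by simp
  hence "card A \<le> V.dim" using V.li_le_dim[OF fd] AU subspD(1)[OF U] by blast
  thus ?thesis using U.dim_basis[OF A] by simp
qed

lemma subsp_inter: "subsp V U \<Longrightarrow> subsp V P \<Longrightarrow> subsp V (U \<inter> P)"
  unfolding subsp_def by blast

lemma subsp_trans: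
  assumes "subsp V U" "subsp V P" "P \<subseteq> U" shows "subsp (restr V U) P"
  using assms by (auto simp: subsp_def)

lemma subsp_dim_mono:
  assumes "vspace V" "fd_space (restr V U)" "subsp V U" "subsp V P" "P \<subseteq> U"
  shows "vdim (restr V P) \<le> vdim (restr V U)"
  using subsp_dim_le[OF assms(2) subsp_trans[OF assms(3-5)]] by simp

lemma image_subsp:
  assumes "lin V W T" "subsp V U" shows "subsp W (T ` U)"
proof -
  note D = linD[OF assms(1)] and S = subspD[OF assms(2)]
  show ?thesis unfolding subsp_def
  proof (intro conjI ballI allI)
    show "T ` U \<subseteq> carrier W" using D(3) S(5) by blast
    show "\<zero>\<^bsub>W\<^esub> \<in> T ` U" using D(6) S(2) by (metis imageI)
  next
    fix u v assume "u \<in> T ` U" "v \<in> T ` U"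
    then obtain u' v' where "u = T u'" "v = T v'" "u' \<in> U" "v' \<in> U" by auto
    thus "u \<oplus>\<^bsub>W\<^esub> v \<in> T ` U" using D(4)[of u' v'] S(3,5) by (metis imageI)
  next
    fix a u assume "u \<in> T ` U"
    then obtain u' where "u = T u'" "u' \<in> U" by auto
    thus "a \<odot>\<^bsub>W\<^esub> u \<in> T ` U" using D(5)[of u' a] S(4,5) by (metis imageI)
  qed
qed

lemma ker_subsp:
  assumes "lin V W T" shows "subsp V {v \<in> carrier V. T v = \<zero>\<^bsub>W\<^esub>}"
  using linD[OF assms] vspace_simps[OF linD(1)[OF assms]] vspace_simps[OF linD(2)[OF assms]]
  unfolding subsp_def by (auto simp only: mem_Collect_eq)

lemma lin_restr:
  assumes "lin V W T" "subsp V U" shows "lin (restr V U) W T"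
  using linD[OF assms(1)] subspD[OF assms(2)] restr_vspace[OF linD(1)[OF assms(1)] assms(2)]
  by (intro linI) auto

lemma rank_nullity_restr:
  assumes T: "lin V W T" and U: "subsp V U" "fd_space (restr V U)"
  shows "vdim (restr W (T ` U)) + vdim (restr V {v \<in> U. T v = \<zero>\<^bsub>W\<^esub>}) = vdim (restr V U)"
proof -
  interpret linear_map class_ring "restr V U" W T by (rule lin_restr[OF T U(1)])
  have "V.fin_dim" using U by (simp add: fd_space_def)
  from rank_nullity[OF this] show ?thesis
    by (simp add: im_def ker_def)
qed

text \<open>
The kernel of \<open>T\<close> on \<open>P\<close> is contained in its kernel on \<open>Q\<close>, so \<open>T\<close> loses at most as much dimension
on \<open>P\<close> as on \<open>Q\<close>. This is the Frobenius rank inequality.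
\<close>

lemma frobenius_inequality:
  assumes T: "lin V W T" and Q: "subsp V Q" "fd_space (restr V Q)" and P: "subsp V P" "P \<subseteq> Q"
  shows "vdim (restr W (T ` Q)) + vdim (restr V P) \<le> vdim (restr V Q) + vdim (restr W (T ` P))"
proof -
  note V = linD(1)[OF T]
  have fP: "fd_space (restr V P)" using subsp_fin_dim[OF Q(2) subsp_trans[OF Q(1) P]] by simp
  have k: "subsp V {v \<in> U. T v = \<zero>\<^bsub>W\<^esub>}" if U: "subsp V U" for U
  proof -
    have "U \<inter> {v \<in> carrier V. T v = \<zero>\<^bsub>W\<^esub>} = {v \<in> U. T v = \<zero>\<^bsub>W\<^esub>}" using subspD(1)[OF U] by blast
    thus ?thesis using subsp_inter[OF U ker_subsp[OF T]] by simp
  qed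
  have fk: "fd_space (restr V {v \<in> Q. T v = \<zero>\<^bsub>W\<^esub>})"
    using subsp_fin_dim[OF Q(2) subsp_trans[OF Q(1) k[OF Q(1)]]] by simp
  have "vdim (restr V {v \<in> P. T v = \<zero>\<^bsub>W\<^esub>}) \<le> vdim (restr V {v \<in> Q. T v = \<zero>\<^bsub>W\<^esub>})"
    by (rule subsp_dim_mono[OF V fk k[OF Q(1)] k[OF P(1)]]) (use P in auto)
  thus ?thesis using rank_nullity_restr[OF T Q] rank_nullity_restr[OF T P(1) fP] by linarith
qed

text \<open>
The field as a vector space over itself, which makes the rank-nullity theorem applicable to
functionals.
\<close>

definition line :: "('k::field, 'k) module" where
  "line = \<lparr>carrier = UNIV, mult = undefined, one = undefined, zero = 0, add = (+), smult = (*)\<rparr>"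

lemma line_vspace: "vspace line"
  by (rule vs_criteria[OF class_ring_field])
     (auto simp: line_def algebra_simps intro: exI[of _ "- v" for v])

lemma line_dim: "vdim line = 1"
proof -
  interpret vectorspace class_ring line by (rule line_vspace)
  have "submodule class_ring (span {1}) line" by (rule span_is_submodule) (simp add: line_def)
  moreover have "1 \<in> span {1}" by (rule subsetD[OF in_own_span]) (auto simp: line_def)
  ultimately have "a \<odot>\<^bsub>line\<^esub> 1 \<in> span {1}" for a
    using submodule.smult_closed[of class_ring "span {1}" line a 1] by simp
  hence "span {1} = carrier line" by (auto simp: line_def)
  thus ?thesis by (intro dim1I) (auto simp: line_def)
qed

lemma functional_lin: "vspace V \<Longrightarrow> functional V l \<Longrightarrow> lin V line l"
  by (intro linI line_vspace) (auto simp: functional_def line_def)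

lemma functional_ker_subsp:
  assumes "vspace V" "functional V l" shows "subsp V {v \<in> carrier V. l v = 0}"
  using ker_subsp[OF functional_lin[OF assms]] by (simp add: line_def)

lemma functional_restr: "functional V l \<Longrightarrow> subsp V U \<Longrightarrow> functional (restr V U) l"
  by (drule subspD(1)) (auto simp: functional_def subset_iff)

lemma dim_functional:
  fixes V :: "('k::field, 'v) module"
  assumes V: "fd_space V" and l: "functional V l" and e: "e \<in> carrier V" "l e = 1"
  shows "vdim V = Suc (vdim (restr V {v \<in> carrier V. l v = 0}))"
proof -
  have vs: "vspace V" using V by (simp add: fd_space_def)
  have "a \<in> l ` carrier V" for a
  proof -
    have "l (a \<odot>\<^bsub>V\<^esub> e) = a" using l e by (simp add: functional_def)
    thus ?thesis using vspace_simps(3)[OF vs e(1)] by (metis imageI)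
  qed
  hence *: "restr line (l ` carrier V) = line" by (auto simp: line_def)
  have "vdim (line :: ('k, 'k) module) + vdim (restr V {v \<in> carrier V. l v = \<zero>\<^bsub>line\<^esub>}) = vdim V"
    using rank_nullity_restr[OF functional_lin[OF vs l] subsp_carrier[OF vs]] V unfolding * by simp
  moreover have "\<zero>\<^bsub>line\<^esub> = (0::'k)" by (simp add: line_def)
  ultimately show ?thesis unfolding line_dim by simp
qed

text \<open>
Extend \<open>{v}\<close> to a basis; the coefficient at \<open>v\<close> is the functional.
\<close>

lemma exists_functional:
  assumes V: "fd_space V" and v: "v \<in> carrier V" "v \<noteq> \<zero>\<^bsub>V\<^esub>"
  obtains l where "functional V l" "l v = 1"
proof -
  have vs: "vspace V" and fd: "vectorspace.fin_dim class_ring V"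
    using V by (auto simp: fd_space_def)
  interpret V: vectorspace class_ring V by fact
  let ?P = "\<lambda>S. v \<in> S \<and> S \<subseteq> carrier V \<and> V.lin_indpt S"
  have "V.span {} = {\<zero>\<^bsub>V\<^esub>}" by (rule V.span_empty)
  moreover have "V.lin_indpt {}" by (simp add: V.lin_dep_def)
  ultimately have li: "V.lin_indpt {v}" using V.lin_dep_iff_in_span[of "{}" v] v by auto
  have "\<exists>A. finite A \<and> maximal A ?P"
    using V.li_le_dim[OF fd] li v by (intro maximal_exists[where B = "{v}" and N = V.dim]) auto
  then obtain A where A: "finite A" "maximal A ?P" by auto
  hence "maximal A (\<lambda>S. S \<subseteq> carrier V \<and> V.lin_indpt S)"
    unfolding maximal_def by (metis (no_types, lifting) subsetD)
  hence "V.basis A" by (rule V.max_li_is_basis)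
  moreover have vA: "v \<in> A" "A \<subseteq> carrier V" using A(2) by (auto simp: maximal_def)
  ultimately have ex1: "\<exists>!a. a \<in> A \<rightarrow>\<^sub>E UNIV \<and> V.lincomb a A = u" if "u \<in> carrier V" for u
    using V.basis_criterion[OF A(1), unfolded class_ring_simps] that by auto
  define co where "co u = (THE a. a \<in> A \<rightarrow>\<^sub>E UNIV \<and> V.lincomb a A = u)" for u
  have co: "co u \<in> A \<rightarrow>\<^sub>E UNIV \<and> V.lincomb (co u) A = u" if "u \<in> carrier V" for u
    unfolding co_def by (rule theI'[OF ex1[OF that]])
  have coI: "co u = restrict a A" if "V.lincomb a A = u" for u a
  proof -
    have eq: "V.lincomb (restrict a A) A = u"
      using V.lincomb_cong[of A A "restrict a A" a] vA that by simp
    moreover have "V.lincomb a A \<in> carrier V" using vA by (intro V.lincomb_closed) auto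
    ultimately show ?thesis unfolding co_def using that by (intro the1_equality ex1) auto
  qed
  have "co (u \<oplus>\<^bsub>V\<^esub> w) v = co u v + co w v" if "u \<in> carrier V" "w \<in> carrier V" for u w
  proof -
    have "V.lincomb (\<lambda>x. co u x + co w x) A = u \<oplus>\<^bsub>V\<^esub> w"
      using V.lincomb_sum[OF A(1) vA(2), of "co u" "co w"] co[OF that(1)] co[OF that(2)] by simp
    from coI[OF this] show ?thesis using vA by simp
  qed
  moreover have "co (c \<odot>\<^bsub>V\<^esub> u) v = c * co u v" if "u \<in> carrier V" for u c
  proof -
    have "V.lincomb (\<lambda>x. c * co u x) A = c \<odot>\<^bsub>V\<^esub> u"
      using V.lincomb_smult[OF vA(2), of "co u" c] co[OF that(1)] by simp
    from coI[OF this] show ?thesis using vA by simp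
  qed
  moreover have "co v v = 1"
  proof -
    have "V.lincomb (\<lambda>x. if x = v then 1 else 0) A = v"
    proof -
      have "V.lincomb (\<lambda>x. if x = v then 1 else 0) A =
        1 \<odot>\<^bsub>V\<^esub> v \<oplus>\<^bsub>V\<^esub> V.lincomb (\<lambda>x. if x = v then 1 else 0) (A - {v})"
        using V.lincomb_del2[OF A(1) vA(2) _ vA(1), of "\<lambda>x. if x = v then 1 else 0"] by simp
      also have "V.lincomb (\<lambda>x. if x = v then 1 else 0) (A - {v}) = \<zero>\<^bsub>V\<^esub>"
        using vA(2) vspace_simps[OF vs] by (intro V.lincomb_zero) auto
      finally show ?thesis using vspace_simps[OF vs]  v(1) by simp
    qed
    from coI[OF this] show ?thesis using vA by simp
  qed
  ultimately show thesis by (intro that[of "\<lambda>u. co u v"]) (auto simp: functional_def)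
qed

lemma dim_zero:
  assumes "vspace V" "carrier V = {\<zero>\<^bsub>V\<^esub>}" shows "vdim V = 0"
proof -
  interpret vectorspace class_ring V by fact
  have "span {\<zero>\<^bsub>V\<^esub>} = carrier V"
    using assms in_own_span[of "{\<zero>\<^bsub>V\<^esub>}"] span_is_subset2[of "{\<zero>\<^bsub>V\<^esub>}"] by auto
  thus ?thesis by (rule dim0I)
qed

text \<open>
The kernel of one of the functionals satisfies the hypotheses for the others and has dimension one
less. Computing dimensions in this way avoids choosing bases.
\<close>

lemma dim_eq_card_coordinates:
  assumes "finite J" "fd_space V" "\<And>j. j \<in> J \<Longrightarrow> functional V (l j)"
    and "\<And>v. v \<in> carrier V \<Longrightarrow> (\<And>j. j \<in> J \<Longrightarrow> l j v = 0) \<Longrightarrow> v = \<zero>\<^bsub>V\<^esub>"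
    and "\<And>c. \<exists>v\<in>carrier V. \<forall>j\<in>J. l j v = c j"
  shows "vdim V = card J"
  using assms
proof (induction J arbitrary: V rule: finite_induct)
  case (empty V)
  hence V: "vspace V" by (simp add: fd_space_def)
  have "carrier V \<subseteq> {\<zero>\<^bsub>V\<^esub>}" using empty.prems(3) by blast
  hence "carrier V = {\<zero>\<^bsub>V\<^esub>}" using vspace_simps(1)[OF V] by blast
  thus ?case using dim_zero[OF V] by simp
next
  case (insert i J V)
  have vs: "vspace V" using insert.prems(1) by (simp add: fd_space_def)
  let ?U = "{v \<in> carrier V. l i v = 0}"
  have U: "subsp V ?U" by (rule functional_ker_subsp[OF vs]) (simp add: insert.prems)
  obtain e where e: "e \<in> carrier V" "l i e = 1" using insert.prems(4)[of "\<lambda>_. 1"] by auto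
  have "vdim (restr V ?U) = card J"
  proof (rule insert.IH)
    show "fd_space (restr V ?U)" by (rule subsp_fin_dim[OF insert.prems(1) U])
    show "functional (restr V ?U) (l j)" if "j \<in> J" for j
      using functional_restr[OF insert.prems(2) U] that by simp
    show "v = \<zero>\<^bsub>restr V ?U\<^esub>" if "v \<in> carrier (restr V ?U)" "\<And>j. j \<in> J \<Longrightarrow> l j v = 0" for v
      using insert.prems(3)[of v] that by auto
    show "\<exists>v\<in>carrier (restr V ?U). \<forall>j\<in>J. l j v = c j" for c
    proof -
      obtain v where "v \<in> carrier V" "\<forall>j\<in>insert i J. l j v = (if j = i then 0 else c j)"
        using insert.prems(4)[of "\<lambda>j. if j = i then 0 else c j"] by blast
      thus ?thesis using insert.hyps(2) by (intro bexI[of _ v]) auto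
    qed
  qed
  thus ?case using dim_functional[OF insert.prems(1,2) e] insert.hyps by simp
qed


section \<open>Persistence modules and interval decompositions\<close>

text \<open>
The vertices run over all natural numbers, with zero spaces outside \<open>1, \<dots>, n\<close>. A shift by \<open>\<delta>\<close> is
then just an index \<open>x + \<delta>\<close>, and the borders of the quiver need no separate treatment.
\<close>

definition persistence_module :: "nat \<Rightarrow> ('k::field, 'v) rep \<Rightarrow> bool" where
  "persistence_module n M \<longleftrightarrow> (\<forall>x. fd_space (space_at M x)) \<and>
     (\<forall>x. lin (space_at M x) (space_at M (Suc x)) (arrow M x)) \<and>
     (\<forall>x. x = 0 \<or> n < x \<longrightarrow> carrier (space_at M x) = {\<zero>\<^bsub>space_at M x\<^esub>})"

abbreviation zero_at :: "('k, 'v) rep \<Rightarrow> nat \<Rightarrow> 'v" where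
  "zero_at M x \<equiv> \<zero>\<^bsub>space_at M x\<^esub>"

abbreviation vecs :: "('k, 'v) rep \<Rightarrow> nat \<Rightarrow> 'v set" where
  "vecs M x \<equiv> carrier (space_at M x)"

lemma persistence_moduleD:
  assumes "persistence_module n M"
  shows "fd_space (space_at M x)" "vspace (space_at M x)"
    "lin (space_at M x) (space_at M (Suc x)) (arrow M x)"
    "x = 0 \<or> n < x \<Longrightarrow> vecs M x = {zero_at M x}"
  using assms by (auto simp: persistence_module_def fd_space_def)

lemma lin_comp:
  assumes "lin U V S" "lin V W T" shows "lin U W (T \<circ> S)"
  using linD[OF assms(1)] linD[OF assms(2)] by (intro linI) simp_all

lemma path_map_lin:
  assumes "persistence_module n M"
  shows "lin (space_at M x) (space_at M (x + k)) (path_map M x k)"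
proof (induction k)
  case 0
  show ?case by (rule linI) (simp_all add: persistence_moduleD[OF assms])
next
  case (Suc k)
  show ?case using lin_comp[OF Suc persistence_moduleD(3)[OF assms]] by (simp add: comp_def)
qed

lemma path_map_add: "path_map M x (j + k) v = path_map M (x + j) k (path_map M x j v)"
  by (induction k) (simp_all add: add.assoc)

lemma path_map_Suc_left: "path_map M x (Suc k) v = path_map M (Suc x) k (arrow M x v)"
  using path_map_add[of M x 1 k v] by simp

definition alive :: "nat \<Rightarrow> (nat \<times> nat) \<times> nat \<Rightarrow> bool" where
  "alive x j \<longleftrightarrow> fst (fst j) \<le> x \<and> x \<le> snd (fst j)"

text \<open>
An isomorphism from \<open>M\<close> to the sum of the interval representations of \<open>B\<close>, written as the family
of its components: \<open>l x j\<close> is the coordinate at the vertex \<open>x\<close> that belongs to the bar \<open>j\<close>. The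
clauses say that it is linear, lands in the sum, is injective, is surjective, and commutes with the
structure maps.
\<close>

definition bar_coordinates ::
  "('k::field, 'v) rep \<Rightarrow> (nat \<times> nat) multiset \<Rightarrow> (nat \<Rightarrow> (nat \<times> nat) \<times> nat \<Rightarrow> 'v \<Rightarrow> 'k) \<Rightarrow> bool"
where
  "bar_coordinates M B l \<longleftrightarrow>
     (\<forall>x. \<forall>j\<in>copies B. functional (space_at M x) (l x j)) \<and>
     (\<forall>x. \<forall>j\<in>copies B. \<not> alive x j \<longrightarrow> (\<forall>v\<in>vecs M x. l x j v = 0)) \<and>
     (\<forall>x. \<forall>v\<in>vecs M x. (\<forall>j\<in>copies B. l x j v = 0) \<longrightarrow> v = zero_at M x) \<and>
     (\<forall>x c. \<exists>v\<in>vecs M x. \<forall>j\<in>copies B. alive x j \<longrightarrow> l x j v = c j) \<and>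
     (\<forall>x. \<forall>v\<in>vecs M x. \<forall>j\<in>copies B.
        l (Suc x) j (arrow M x v) = (if alive x j \<and> alive (Suc x) j then l x j v else 0))"

lemma bar_coordinatesD:
  assumes "bar_coordinates M B l"
  shows "j \<in> copies B \<Longrightarrow> functional (space_at M x) (l x j)"
    "j \<in> copies B \<Longrightarrow> \<not> alive x j \<Longrightarrow> v \<in> vecs M x \<Longrightarrow> l x j v = 0"
    "v \<in> vecs M x \<Longrightarrow> (\<And>j. j \<in> copies B \<Longrightarrow> l x j v = 0) \<Longrightarrow> v = zero_at M x"
    "\<exists>v\<in>vecs M x. \<forall>j\<in>copies B. alive x j \<longrightarrow> l x j v = c j"
    "v \<in> vecs M x \<Longrightarrow> j \<in> copies B \<Longrightarrow>
        l (Suc x) j (arrow M x v) = (if alive x j \<and> alive (Suc x) j then l x j v else 0)"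
  using assms unfolding bar_coordinates_def by blast+

lemma copies_add_mset: "copies (add_mset J B) = insert (J, count B J) (copies B)"
  by (auto simp: copies_def less_Suc_eq split: if_splits)

lemma new_copy: "(J, count B J) \<notin> copies B"
  by (simp add: copies_def)

lemma finite_copies: "finite (copies B)"
  by (induction B) (simp_all add: copies_add_mset, simp add: copies_def)

definition subrep :: "('k, 'v) rep \<Rightarrow> (nat \<Rightarrow> 'v set) \<Rightarrow> ('k, 'v) rep" where
  "subrep M C = \<lparr>space_at = (\<lambda>x. restr (space_at M x) (C x)), arrow = arrow M\<rparr>"

text \<open>
The vectors \<open>e x\<close> span a copy of \<open>I[b,d]\<close> in \<open>M\<close>, and the functionals \<open>c x\<close> form a retraction onto
it, so that their kernels form a complementary subrepresentation.
\<close>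

definition bar_splitting ::
  "('k::field, 'v) rep \<Rightarrow> nat \<Rightarrow> nat \<Rightarrow> (nat \<Rightarrow> 'v \<Rightarrow> 'k) \<Rightarrow> (nat \<Rightarrow> 'v) \<Rightarrow> bool" where
  "bar_splitting M b d c e \<longleftrightarrow>
     (\<forall>x. functional (space_at M x) (c x)) \<and>
     (\<forall>x. e x \<in> vecs M x) \<and>
     (\<forall>x. b \<le> x \<and> x \<le> d \<longrightarrow> c x (e x) = 1) \<and>
     (\<forall>x. \<forall>w\<in>vecs M x. \<not> (b \<le> x \<and> x \<le> d) \<longrightarrow> c x w = 0) \<and>
     (\<forall>x. \<forall>w\<in>vecs M x. c (Suc x) (arrow M x w) = (if Suc x \<le> d then c x w else 0)) \<and>
     (\<forall>x. b \<le> x \<longrightarrow> arrow M x (e x) = e (Suc x)) \<and>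
     (\<forall>x. d < x \<longrightarrow> e x = zero_at M x)"

lemma bar_splittingD:
  assumes "bar_splitting M b d c e"
  shows "functional (space_at M x) (c x)"
    "e x \<in> vecs M x"
    "b \<le> x \<Longrightarrow> x \<le> d \<Longrightarrow> c x (e x) = 1"
    "w \<in> vecs M x \<Longrightarrow> \<not> (b \<le> x \<and> x \<le> d) \<Longrightarrow> c x w = 0"
    "w \<in> vecs M x \<Longrightarrow> c (Suc x) (arrow M x w) = (if Suc x \<le> d then c x w else 0)"
    "b \<le> x \<Longrightarrow> arrow M x (e x) = e (Suc x)"
    "d < x \<Longrightarrow> e x = zero_at M x"
  using assms unfolding bar_splitting_def by blast+

text \<open>
Let \<open>b\<close> be the first vertex with a nonzero space and let \<open>v\<close> in \<open>M\<^sub>b\<close> survive as long as possible,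
up to \<open>d\<close>. A functional on \<open>M\<^sub>d\<close> with value 1 on the image of \<open>v\<close>, pulled back along the structure
maps, is a retraction onto the interval spanned by \<open>v\<close>: nothing has to be checked before \<open>b\<close>, where
the spaces vanish, nor after \<open>d\<close>, where \<open>v\<close> does.
\<close>

lemma exists_bar_splitting:
  assumes M: "persistence_module n M" and nz: "vecs M x \<noteq> {zero_at M x}"
  obtains b d c e where "1 \<le> b" "b \<le> d" "d \<le> n" "bar_splitting M b d c e"
proof -
  note P = persistence_moduleD[OF M]
  define b where "b = (LEAST x. vecs M x \<noteq> {zero_at M x})"
  have b: "vecs M b \<noteq> {zero_at M b}" unfolding b_def by (rule LeastI[of _ x]) fact
  have below: "vecs M y = {zero_at M y}" if "y < b" for y
    using not_less_Least[of y] that unfolding b_def by blast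
  have b1: "1 \<le> b" using b P(4)[of b] by (cases "b = 0") auto
  \<comment> \<open>The vertices that some vector of \<open>M\<^sub>b\<close> reaches without becoming zero.\<close>
  define D where "D = {y. b \<le> y \<and> (\<exists>v\<in>vecs M b. path_map M b (y - b) v \<noteq> zero_at M y)}"
  have Dn: "y \<le> n" if yD: "y \<in> D" for y
  proof (rule ccontr)
    assume "\<not> y \<le> n"
    hence "vecs M y = {zero_at M y}" using P(4) by simp
    moreover obtain v where "b \<le> y" "v \<in> vecs M b" "path_map M b (y - b) v \<noteq> zero_at M y"
      using yD unfolding D_def by blast
    ultimately show False using linD(3)[OF path_map_lin[OF M, of b "y - b"], of v] by simp
  qed
  hence "D \<subseteq> {..n}" by auto
  hence fin: "finite D" by (rule finite_subset) simp
  obtain v0 where "v0 \<in> vecs M b" "v0 \<noteq> zero_at M b"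
    using b vspace_simps(1)[OF P(2)[of b]] by blast
  hence bD: "b \<in> D" by (auto simp: D_def)
  define d where "d = Max D"
  have dD: "d \<in> D" unfolding d_def using fin bD by (intro Max_in) auto
  have SdD: "Suc d \<notin> D" using Max_ge[OF fin, of "Suc d"] unfolding d_def by auto
  obtain v where bd: "b \<le> d" and v: "v \<in> vecs M b" "path_map M b (d - b) v \<noteq> zero_at M d"
    using dD by (auto simp: D_def)
  have path_in: "path_map M b (y - b) v \<in> vecs M y" if "b \<le> y" for y
    using linD(3)[OF path_map_lin[OF M, of b "y - b"] v(1)] that by simp
  obtain l where l: "functional (space_at M d) l" "l (path_map M b (d - b) v) = 1"
    by (rule exists_functional[OF P(1) path_in[OF bd] v(2)])
  define e where "e y = (if b \<le> y \<and> y \<le> d then path_map M b (y - b) v else zero_at M y)" for y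
  define c where "c y w = (if y \<le> d then l (path_map M y (d - y) w) else 0)" for y w
  show thesis
  proof (rule that[of b d c e])
    show "1 \<le> b" "b \<le> d" "d \<le> n" using b1 bd Dn[OF dD] by auto
    have fc: "functional (space_at M y) (c y)" for y
    proof (cases "y \<le> d")
      case True
      hence "lin (space_at M y) (space_at M d) (path_map M y (d - y))"
        using path_map_lin[OF M, of y "d - y"] by simp
      from linD[OF this] show ?thesis using l(1) True by (simp add: functional_def c_def)
    qed (simp add: functional_def c_def)
    have e_in: "e y \<in> vecs M y" for y using path_in vspace_simps(1)[OF P(2)] by (simp add: e_def)
    have ce: "c y (e y) = 1" if "b \<le> y" "y \<le> d" for y
      using path_map_add[of M b "y - b" "d - y" v] that l(2) by (simp add: e_def c_def)
    have c0: "c y w = 0" if w: "w \<in> vecs M y" and "\<not> (b \<le> y \<and> y \<le> d)" for y w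
    proof (cases "y < b")
      case True
      hence "w = zero_at M y" using below w by auto
      hence "w = 0 \<odot>\<^bsub>space_at M y\<^esub> w" using vspace_simps(8)[OF P(2)] by metis
      thus ?thesis using fc[of y] w unfolding functional_def by (metis mult_zero_left)
    qed (use that in \<open>auto simp: c_def\<close>)
    have ca: "c (Suc y) (arrow M y w) = (if Suc y \<le> d then c y w else 0)" if "w \<in> vecs M y" for y w
    proof (cases "Suc y \<le> d")
      case True
      hence "d - y = Suc (d - Suc y)" by simp
      thus ?thesis using path_map_Suc_left[of M y "d - Suc y" w] True unfolding c_def by simp
    qed (simp add: c_def)
    have e0: "d < y \<Longrightarrow> e y = zero_at M y" for y by (simp add: e_def)
    have ae: "arrow M y (e y) = e (Suc y)" if "b \<le> y" for y
    proof (cases "y < d")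
      case True
      thus ?thesis using that by (simp add: e_def Suc_diff_le)
    next
      case False
      have "arrow M y (path_map M b (y - b) v) = zero_at M (Suc y)" if "y = d"
        using SdD that v(1) bd by (auto simp: D_def Suc_diff_le)
      thus ?thesis using that False linD(6)[OF P(3)] by (auto simp: e_def)
    qed
    show "bar_splitting M b d c e"
      unfolding bar_splitting_def using fc e_in ce c0 ca ae e0 by blast
  qed
qed

text \<open>
The projection \<open>p\<close> along the split interval onto the kernel of \<open>c\<close> commutes with the structure maps.
So the coordinates on the kernel, composed with \<open>p\<close>, together with \<open>c\<close> itself are coordinates on \<open>M\<close>.
\<close>

lemma extend_bar_coordinates:
  fixes M :: "('k::field, 'v) rep"
  assumes M: "persistence_module n M" and S: "bar_splitting M b d c e"
    and l: "bar_coordinates (subrep M (\<lambda>x. {w \<in> vecs M x. c x w = 0})) B l"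
  shows "\<exists>l'. bar_coordinates M (add_mset (b, d) B) l'"
proof -
  note P = persistence_moduleD[OF M]
  note c = bar_splittingD(1)[OF S] and e = bar_splittingD(2)[OF S] and ce = bar_splittingD(3)[OF S]
    and c0 = bar_splittingD(4)[OF S] and ca = bar_splittingD(5)[OF S] and ae = bar_splittingD(6)[OF S]
    and e0 = bar_splittingD(7)[OF S]
  have c_add: "c x (u \<oplus>\<^bsub>space_at M x\<^esub> v) = c x u + c x v" if "u \<in> vecs M x" "v \<in> vecs M x" for x u v
    using c[of x] that by (simp add: functional_def)
  have c_smult: "c x (r \<odot>\<^bsub>space_at M x\<^esub> u) = r * c x u" if "u \<in> vecs M x" for x u r
    using c[of x] that by (simp add: functional_def)
  note vsp = vspace_simps[OF P(2)]
  note vac = vspace_ac[OF P(2)]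
  note vdi = vspace_distrib[OF P(2)]
  define C where "C x = {w \<in> vecs M x. c x w = 0}" for x
  define N where "N = subrep M C"
  have N_sp: "space_at N x = restr (space_at M x) (C x)" and N_ar: "arrow N x = arrow M x" for x
    by (simp_all add: N_def subrep_def)
  have "bar_coordinates N B l" using l unfolding N_def C_def .
  note L = bar_coordinatesD[OF this, unfolded N_sp N_ar, simplified]
  define p where "p x w = w \<oplus>\<^bsub>space_at M x\<^esub> (- c x w) \<odot>\<^bsub>space_at M x\<^esub> e x" for x w
  define new where "new = ((b, d), count B (b, d))"
  define l' where "l' x j w = (if j = new then c x w else l x j (p x w))" for x j w
  have new: "new \<notin> copies B" unfolding new_def by (rule new_copy)
  have al: "alive x new \<longleftrightarrow> b \<le> x \<and> x \<le> d" for x by (simp add: alive_def new_def)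
  have pM: "p x w \<in> vecs M x" if "w \<in> vecs M x" for x w using that e by (simp add: p_def vsp)
  have pC: "p x w \<in> C x" if "w \<in> vecs M x" for x w
  proof -
    have "c x (p x w) = c x w + - c x w * c x (e x)"
      unfolding p_def using that e by (simp only: c_add c_smult vsp)
    thus ?thesis using pM[OF that] ce[of x] c0[OF that] by (auto simp: C_def)
  qed
  have p_fix: "p x w = w" if "w \<in> vecs M x" "c x w = 0" for x w
    using that e[of x] by (simp add: p_def vsp)
  have p_add: "p x (u \<oplus>\<^bsub>space_at M x\<^esub> v) = p x u \<oplus>\<^bsub>space_at M x\<^esub> p x v"
    if "u \<in> vecs M x" "v \<in> vecs M x" for x u v
  proof -
    have "- (c x u + c x v) = - c x u + - c x v" by simp
    thus ?thesis unfolding p_def c_add[OF that] using that e[of x]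
      by (simp only: vdi vac vsp)
  qed
  have p_smult: "p x (r \<odot>\<^bsub>space_at M x\<^esub> u) = r \<odot>\<^bsub>space_at M x\<^esub> p x u"
    if "u \<in> vecs M x" for x u r
  proof -
    have "- (r * c x u) = r * - c x u" by simp
    thus ?thesis unfolding p_def c_smult[OF that] using that e[of x]
      by (simp only: vdi vsp)
  qed
  have p_arrow: "p (Suc x) (arrow M x w) = arrow M x (p x w)" if w: "w \<in> vecs M x" for x w
  proof -
    have aw: "arrow M x w \<in> vecs M (Suc x)" using linD(3)[OF P(3) w] .
    have lhs: "p (Suc x) (arrow M x w) = arrow M x w \<oplus>\<^bsub>space_at M (Suc x)\<^esub>
        (- (if Suc x \<le> d then c x w else 0)) \<odot>\<^bsub>space_at M (Suc x)\<^esub> e (Suc x)"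
      by (simp add: p_def ca[OF w])
    have rhs: "arrow M x (p x w) = arrow M x w \<oplus>\<^bsub>space_at M (Suc x)\<^esub>
        (- c x w) \<odot>\<^bsub>space_at M (Suc x)\<^esub> arrow M x (e x)"
      using w e[of x] linD(4,5)[OF P(3)[of x]] by (simp add: p_def vsp)
    show ?thesis
    proof (cases "b \<le> x \<and> x \<le> d")
      case False
      thus ?thesis unfolding lhs rhs c0[OF w False]
        using e[of "Suc x"] linD(3)[OF P(3) e[of x]] by (simp add: vsp)
    next
      case True
      show ?thesis
      proof (cases "x = d")
        case xd: True
        hence "e (Suc x) = zero_at M (Suc x)" using e0 by simp
        thus ?thesis unfolding lhs rhs using ae[of x] True aw by (simp add: vsp)
      qed (use True lhs rhs ae in auto)
    qed
  qed
  have "bar_coordinates M (add_mset (b, d) B) l'"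
    unfolding bar_coordinates_def copies_add_mset new_def[symmetric]
  proof (intro conjI allI ballI impI)
    fix x j assume j: "j \<in> insert new (copies B)"
    show "functional (space_at M x) (l' x j)"
    proof (cases "j = new")
      case True
      thus ?thesis using c by (simp add: l'_def[abs_def])
    next
      case False
      hence "functional (restr (space_at M x) (C x)) (l x j)" using L(1)[of j x] j by simp
      thus ?thesis using False pC by (simp add: functional_def l'_def p_add p_smult)
    qed
  next
    fix x j v assume j: "j \<in> insert new (copies B)" "\<not> alive x j" and v: "v \<in> vecs M x"
    show "l' x j v = 0"
    proof (cases "j = new")
      case True
      thus ?thesis using c0[OF v] al j(2) by (simp add: l'_def)
    next
      case False
      hence "l x j (p x v) = 0" using L(2)[OF _ j(2) pC[OF v]] j(1) by simp
      thus ?thesis using False by (simp add: l'_def)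
    qed
  next
    fix x v assume v: "v \<in> vecs M x" and 0: "\<forall>j\<in>insert new (copies B). l' x j v = 0"
    hence cv: "c x v = 0" by (simp add: l'_def)
    have "l x j v = 0" if j: "j \<in> copies B" for j
    proof -
      have "j \<noteq> new" using j new by metis
      moreover have "l' x j v = 0" using 0 j by blast
      ultimately show ?thesis using p_fix[OF v cv] by (simp add: l'_def)
    qed
    moreover have "v \<in> C x" using v cv by (simp add: C_def)
    ultimately show "v = zero_at M x" using L(3) by blast
  next
    fix x and \<gamma> :: "(nat \<times> nat) \<times> nat \<Rightarrow> 'k"
    obtain u where u: "u \<in> C x" "\<forall>j\<in>copies B. alive x j \<longrightarrow> l x j u = \<gamma> j"
      using L(4)[of x \<gamma>] by blast
    have uM: "u \<in> vecs M x" "c x u = 0" using u(1) by (auto simp: C_def)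
    define g where "g = (if alive x new then \<gamma> new else 0)"
    define w where "w = u \<oplus>\<^bsub>space_at M x\<^esub> g \<odot>\<^bsub>space_at M x\<^esub> e x"
    have w: "w \<in> vecs M x" using uM e by (simp add: w_def vsp)
    have "c x w = g * c x (e x)"
      unfolding w_def using uM e[of x] by (simp add: c_add c_smult vsp)
    hence cw: "c x w = g" using ce[of x] unfolding g_def al by (auto split: if_splits)
    have "p x w = u \<oplus>\<^bsub>space_at M x\<^esub> (g + - g) \<odot>\<^bsub>space_at M x\<^esub> e x"
      unfolding p_def cw unfolding w_def vdi(2)[OF e]
      by (rule vac(1)) (use uM(1) e[of x] in \<open>simp_all add: vsp\<close>)
    hence pw: "p x w = u" using uM(1) e[of x] by (simp add: vsp)
    have "l' x j w = \<gamma> j" if "j \<in> insert new (copies B)" "alive x j" for j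
    proof (cases "j = new")
      case True
      thus ?thesis using cw that(2) by (simp add: l'_def g_def)
    next
      case False
      thus ?thesis using u(2) that pw by (simp add: l'_def)
    qed
    thus "\<exists>v\<in>vecs M x. \<forall>j\<in>insert new (copies B). alive x j \<longrightarrow> l' x j v = \<gamma> j"
      using w by (intro bexI[of _ w] ballI impI)
  next
    fix x v j assume v: "v \<in> vecs M x" and j: "j \<in> insert new (copies B)"
    show "l' (Suc x) j (arrow M x v) = (if alive x j \<and> alive (Suc x) j then l' x j v else 0)"
    proof (cases "j = new")
      case True
      show ?thesis
      proof (cases "b \<le> x \<and> x \<le> d")
        case True
        thus ?thesis unfolding \<open>j = new\<close> al l'_def using ca[OF v] by simp
      next
        case False
        thus ?thesis unfolding \<open>j = new\<close> al l'_def using ca[OF v] c0[OF v False] by simp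
      qed
    next
      case False
      hence "j \<in> copies B" using j by blast
      from L(5)[OF pC[OF v] this] show ?thesis using False unfolding l'_def p_arrow[OF v] by simp
    qed
  qed
  thus ?thesis by blast
qed

text \<open>
Existence of interval decompositions, by induction on the total dimension: split off an interval
and decompose the complement.
\<close>

theorem exists_bar_coordinates:
  assumes "persistence_module n M"
  shows "\<exists>B l. (\<forall>(b, d)\<in>#B. 1 \<le> b \<and> b \<le> d \<and> d \<le> n) \<and> bar_coordinates M B l"
  using assms
proof (induction "\<Sum>x\<in>{1..n}. vdim (space_at M x)" arbitrary: M rule: less_induct)
  case less
  note M = less.prems
  note P = persistence_moduleD[OF M]
  show ?case
  proof (cases "\<forall>x. vecs M x = {zero_at M x}")
    case True
    have "bar_coordinates M {#} (\<lambda>_ _ _. 0)"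
      using True by (simp add: bar_coordinates_def copies_def)
    thus ?thesis by (intro exI[of _ "{#}"] exI) auto
  next
    case False
    then obtain x0 where "vecs M x0 \<noteq> {zero_at M x0}" by blast
    then obtain b d c e where bd: "1 \<le> b" "b \<le> d" "d \<le> n" and S: "bar_splitting M b d c e"
      by (rule exists_bar_splitting[OF M])
    note c = bar_splittingD(1)[OF S] and ca = bar_splittingD(5)[OF S]
    define C where "C x = {w \<in> vecs M x. c x w = 0}" for x
    define N where "N = subrep M C"
    have N_sp: "space_at N x = restr (space_at M x) (C x)" and N_ar: "arrow N x = arrow M x" for x
      by (simp_all add: N_def subrep_def)
    have C: "subsp (space_at M x) (C x)" for x
      unfolding C_def by (rule functional_ker_subsp[OF P(2) c])
    have aC: "arrow M x w \<in> C (Suc x)" if "w \<in> C x" for x w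
      using that ca[of w x] linD(3)[OF P(3)] by (auto simp: C_def)
    have N: "persistence_module n N"
      unfolding persistence_module_def
    proof (intro conjI allI impI)
      fix x
      show "fd_space (space_at N x)" unfolding N_sp by (rule subsp_fin_dim[OF P(1) C])
      show "lin (space_at N x) (space_at N (Suc x)) (arrow N x)"
        unfolding N_sp N_ar
        by (rule linI) (use linD[OF P(3)] aC restr_vspace[OF P(2) C] subspD(5)[OF C] in auto)
      assume "x = 0 \<or> n < x"
      hence "C x \<subseteq> {zero_at M x}" using P(4)[of x] by (auto simp: C_def)
      thus "vecs N x = {zero_at N x}" using subspD(2)[OF C[of x]] by (auto simp: N_sp)
    qed
    have "(\<Sum>x\<in>{1..n}. vdim (space_at N x)) < (\<Sum>x\<in>{1..n}. vdim (space_at M x))"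
    proof (rule sum_strict_mono_ex1)
      show "\<forall>x\<in>{1..n}. vdim (space_at N x) \<le> vdim (space_at M x)"
        unfolding N_sp using subsp_dim_le[OF P(1) C] by blast
      have "vdim (space_at N b) < vdim (space_at M b)"
        using dim_functional[OF P(1) c bar_splittingD(2,3)[OF S], of b] bd by (simp add: N_sp C_def)
      thus "\<exists>x\<in>{1..n}. vdim (space_at N x) < vdim (space_at M x)" using bd by auto
    qed simp
    from less.hyps[OF this N] obtain B l where
      B: "\<forall>(b, d)\<in>#B. 1 \<le> b \<and> b \<le> d \<and> d \<le> n" and l: "bar_coordinates N B l" by blast
    obtain l' where "bar_coordinates M (add_mset (b, d) B) l'"
      using extend_bar_coordinates[OF M S] l unfolding N_def C_def by blast
    moreover have "\<forall>(b, d)\<in>#add_mset (b, d) B. 1 \<le> b \<and> b \<le> d \<and> d \<le> n" using B bd by auto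
    ultimately show ?thesis by blast
  qed
qed


section \<open>Ranks count bars\<close>

definition image_at :: "('k, 'v) rep \<Rightarrow> nat \<Rightarrow> nat \<Rightarrow> 'v set" where
  "image_at M b d = path_map M b (d - b) ` vecs M b"

lemma image_at_subsp:
  assumes M: "persistence_module n M" and "b \<le> d"
  shows "subsp (space_at M d) (image_at M b d)"
  using image_subsp[OF path_map_lin[OF M, of b "d - b"] subsp_carrier[OF persistence_moduleD(2)[OF M]]] assms(2)
  by (simp add: image_at_def)

definition bars_over :: "(nat \<times> nat) multiset \<Rightarrow> nat \<Rightarrow> nat \<Rightarrow> ((nat \<times> nat) \<times> nat) set" where
  "bars_over B b d = {j \<in> copies B. fst (fst j) \<le> b \<and> d \<le> snd (fst j)}"

lemma bar_coordinates_path: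
  assumes l: "bar_coordinates M B l" and M: "persistence_module n M" and v: "v \<in> vecs M b" and j: "j \<in> copies B"
  shows "l (b + k) j (path_map M b k v) = (if alive b j \<and> alive (b + k) j then l b j v else 0)"
proof (induction k)
  case 0
  show ?case using bar_coordinatesD(2)[OF l j _ v] by simp
next
  case (Suc k)
  have "path_map M b k v \<in> vecs M (b + k)" by (rule linD(3)[OF path_map_lin[OF M] v])
  from bar_coordinatesD(5)[OF l this j] Suc
  show ?case by (auto simp: alive_def)
qed

text \<open>
Along the structure map from \<open>b\<close> to \<open>d\<close> a coordinate survives exactly when its bar contains both
vertices, and then it is unchanged. The image is therefore coordinatised by these bars.
\<close>

theorem dim_image_at:
  assumes M: "persistence_module n M" and l: "bar_coordinates M B l" and bd: "b \<le> d"
  shows "vdim (restr (space_at M d) (image_at M b d)) = card (bars_over B b d)"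
proof (rule dim_eq_card_coordinates[where l = "l d"])
  note P = persistence_moduleD[OF M]
  note sub = image_at_subsp[OF M bd]
  have al: "bars_over B b d = {j \<in> copies B. alive b j \<and> alive d j}"
    using bd by (auto simp: bars_over_def alive_def)
  have path: "l d j (path_map M b (d - b) v) = (if alive b j \<and> alive d j then l b j v else 0)"
    if "v \<in> vecs M b" "j \<in> copies B" for v j
    using bar_coordinates_path[OF l M that, of "d - b"] bd by simp
  show "finite (bars_over B b d)" unfolding bars_over_def by (rule finite_subset[OF _ finite_copies[of B]]) auto
  show "fd_space (restr (space_at M d) (image_at M b d))" by (rule subsp_fin_dim[OF P(1) sub])
  show "functional (restr (space_at M d) (image_at M b d)) (l d j)" if "j \<in> bars_over B b d" for j
    using that by (intro functional_restr sub bar_coordinatesD(1)[OF l]) (simp add: bars_over_def)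
  show "w = \<zero>\<^bsub>restr (space_at M d) (image_at M b d)\<^esub>"
    if w: "w \<in> carrier (restr (space_at M d) (image_at M b d))" and 0: "\<And>j. j \<in> bars_over B b d \<Longrightarrow> l d j w = 0" for w
  proof -
    obtain v where v: "v \<in> vecs M b" "w = path_map M b (d - b) v" using w by (auto simp: image_at_def)
    have "w \<in> vecs M d" using w subspD(5)[OF sub] by simp
    moreover have "l d j w = 0" if j: "j \<in> copies B" for j
    proof (cases "j \<in> bars_over B b d")
      case False
      thus ?thesis unfolding v(2) path[OF v(1) j] using al j by auto
    qed (rule 0)
    ultimately have "w = zero_at M d" by (rule bar_coordinatesD(3)[OF l])
    thus ?thesis by simp
  qed
  show "\<exists>w\<in>carrier (restr (space_at M d) (image_at M b d)). \<forall>j\<in>bars_over B b d. l d j w = c j" for c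
  proof -
    obtain v where v: "v \<in> vecs M b" "\<forall>j\<in>copies B. alive b j \<longrightarrow> l b j v = c j"
      using bar_coordinatesD(4)[OF l, of b c] by blast
    have "l d j (path_map M b (d - b) v) = c j" if "j \<in> bars_over B b d" for j
    proof -
      have "j \<in> copies B" "alive b j" "alive d j" using that unfolding al by auto
      thus ?thesis using path[OF v(1), of j] v(2) by simp
    qed
    moreover have "path_map M b (d - b) v \<in> carrier (restr (space_at M d) (image_at M b d))"
      using v(1) by (simp add: image_at_def)
    ultimately show ?thesis by blast
  qed
qed


section \<open>Extension by zero and sums of interval representations\<close>

definition zero_extension :: "nat \<Rightarrow> ('k, 'v) rep \<Rightarrow> ('k, 'v) rep" where
  "zero_extension n M = \<lparr>
     space_at = (\<lambda>x. if 1 \<le> x \<and> x \<le> n then space_at M x else zero_space),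
     arrow = (\<lambda>x. if 1 \<le> x \<and> Suc x \<le> n then arrow M x
       else (\<lambda>_. if 1 \<le> Suc x \<and> Suc x \<le> n then zero_at M (Suc x) else zero_point))\<rparr>"

lemma zero_space_fd: "fd_space (zero_space :: ('k::field, 'v) module)"
proof -
  have V: "vspace (zero_space :: ('k::field, 'v) module)"
    by (rule vs_criteria[OF class_ring_field]) (auto simp: zero_space_def)
  then interpret vectorspace class_ring "zero_space :: ('k::field, 'v) module" .
  have "span {} = carrier (zero_space :: ('k::field, 'v) module)"
    by (subst span_empty) (simp add: zero_space_def)
  hence "fin_dim" unfolding fin_dim_def by (intro exI[of _ "{}"]) simp
  thus ?thesis using V by (simp add: fd_space_def)
qed

lemma zero_lin:
  assumes "vspace V" "vspace W" shows "lin V W (\<lambda>_. \<zero>\<^bsub>W\<^esub>)"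
  using assms vspace_simps[OF assms(2)] by (intro linI) simp_all

lemma zero_extension_inside:
  "1 \<le> x \<Longrightarrow> x \<le> n \<Longrightarrow> space_at (zero_extension n M) x = space_at M x"
  "1 \<le> x \<Longrightarrow> Suc x \<le> n \<Longrightarrow> arrow (zero_extension n M) x = arrow M x"
  by (simp_all add: zero_extension_def)

lemma zero_extension_outside:
  "\<not> (1 \<le> x \<and> x \<le> n) \<Longrightarrow> space_at (zero_extension n M) x = zero_space"
  "\<not> (1 \<le> x \<and> Suc x \<le> n) \<Longrightarrow> arrow (zero_extension n M) x = (\<lambda>_. zero_at (zero_extension n M) (Suc x))"
  by (auto simp: zero_extension_def zero_space_def)

lemma zero_space_carrier: "carrier zero_space = {\<zero>\<^bsub>zero_space\<^esub>}"
  by (simp add: zero_space_def)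

lemma zero_extension_persistence_module:
  assumes "is_rep n M" shows "persistence_module n (zero_extension n M)"
  unfolding persistence_module_def
proof (intro conjI allI impI)
  show fd: "fd_space (space_at (zero_extension n M) x)" for x
    using assms zero_space_fd
    by (cases "1 \<le> x \<and> x \<le> n") (auto simp: zero_extension_inside zero_extension_outside is_rep_def fd_space_def)
  show "lin (space_at (zero_extension n M) x) (space_at (zero_extension n M) (Suc x)) (arrow (zero_extension n M) x)" for x
  proof (cases "1 \<le> x \<and> Suc x \<le> n")
    case True
    thus ?thesis using assms by (simp add: zero_extension_inside is_rep_def)
  next
    case False
    show ?thesis unfolding zero_extension_outside(2)[OF False]
      by (rule zero_lin) (use fd in \<open>simp_all add: fd_space_def\<close>)
  qed
  show "vecs (zero_extension n M) x = {zero_at (zero_extension n M) x}" if "x = 0 \<or> n < x" for x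
    using that zero_space_carrier by (subst (1 2) zero_extension_outside) auto
qed

abbreviation interval_sum :: "(nat \<times> nat) multiset \<Rightarrow> ('k::field, (nat \<times> nat) \<times> nat \<Rightarrow> 'k) rep" where
  "interval_sum B \<equiv> rep_sum (copies B) (\<lambda>((b, d), _). interval_rep b d)"

lemma interval_sum_simps:
  "vecs (interval_sum B) x = (\<Pi>\<^sub>E j\<in>copies B. if alive x j then UNIV else {0})"
  "zero_at (interval_sum B) x = (\<lambda>j\<in>copies B. 0)"
  "u \<oplus>\<^bsub>space_at (interval_sum B) x\<^esub> v = (\<lambda>j\<in>copies B. u j + v j)"
  "a \<odot>\<^bsub>space_at (interval_sum B) x\<^esub> u = (\<lambda>j\<in>copies B. a * u j)"
  "arrow (interval_sum B) x u = (\<lambda>j\<in>copies B. if alive x j \<and> alive (Suc x) j then u j else 0)"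
  by (auto simp: rep_sum_def interval_rep_def case_prod_unfold alive_def PiE_def Pi_def
      intro!: restrict_ext ext)

lemma interval_sum_vspace: "vspace (space_at (interval_sum B) x)"
proof (rule vs_criteria[OF class_ring_field])
  let ?S = "space_at (interval_sum B) x"
  have ext: "u = v" if "u \<in> carrier ?S" "v \<in> carrier ?S" "\<And>j. j \<in> copies B \<Longrightarrow> u j = v j" for u v
    using that unfolding interval_sum_simps by (intro PiE_ext) auto
  show "\<zero>\<^bsub>?S\<^esub> \<in> carrier ?S" unfolding interval_sum_simps by auto
  have add: "u \<oplus>\<^bsub>?S\<^esub> v \<in> carrier ?S" if "u \<in> carrier ?S" "v \<in> carrier ?S" for u v
    using that unfolding interval_sum_simps by (fastforce simp: PiE_iff)
  have smult: "a \<odot>\<^bsub>?S\<^esub> v \<in> carrier ?S" if "v \<in> carrier ?S" for a v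
    using that unfolding interval_sum_simps by (fastforce simp: PiE_iff)
  show "\<forall>v w. v \<in> carrier ?S \<and> w \<in> carrier ?S \<longrightarrow> v \<oplus>\<^bsub>?S\<^esub> w \<in> carrier ?S" using add by blast
  show "\<forall>c v. c \<in> carrier class_ring \<and> v \<in> carrier ?S \<longrightarrow> c \<odot>\<^bsub>?S\<^esub> v \<in> carrier ?S" using smult by blast
  show "\<forall>v\<in>carrier ?S. \<exists>w\<in>carrier ?S. v \<oplus>\<^bsub>?S\<^esub> w = \<zero>\<^bsub>?S\<^esub>"
  proof
    fix v assume v: "v \<in> carrier ?S"
    have "v \<oplus>\<^bsub>?S\<^esub> ((-1) \<odot>\<^bsub>?S\<^esub> v) = \<zero>\<^bsub>?S\<^esub>"
      unfolding interval_sum_simps by (rule restrict_ext) simp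
    thus "\<exists>w\<in>carrier ?S. v \<oplus>\<^bsub>?S\<^esub> w = \<zero>\<^bsub>?S\<^esub>" using smult[OF v] by blast
  qed
  show "\<forall>v\<in>carrier ?S. v \<oplus>\<^bsub>?S\<^esub> \<zero>\<^bsub>?S\<^esub> = v"
    unfolding interval_sum_simps by (auto simp: PiE_iff extensional_restrict cong: restrict_cong)
  show "\<forall>v\<in>carrier ?S. \<one>\<^bsub>class_ring\<^esub> \<odot>\<^bsub>?S\<^esub> v = v"
    unfolding interval_sum_simps by (auto simp: PiE_iff extensional_restrict cong: restrict_cong)
qed (simp_all add: interval_sum_simps algebra_simps cong: restrict_cong)

lemma rep_isoI:
  assumes f: "rep_mor n M N f" and bij: "\<And>x. x \<in> {1..n} \<Longrightarrow> bij_betw (f x) (vecs M x) (vecs N x)"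
    and M: "is_rep n M"
  shows "rep_iso n M N f"
proof -
  define g where "g x = inv_into (vecs M x) (f x)" for x
  have gf: "g x (f x v) = v" if "x \<in> {1..n}" "v \<in> vecs M x" for x v
    unfolding g_def using bij[OF that(1)] that(2) by (simp add: bij_betw_def)
  have fg: "f x (g x w) = w" and g_in: "g x w \<in> vecs M x" if "x \<in> {1..n}" "w \<in> vecs N x" for x w
  proof -
    have "w \<in> f x ` vecs M x" using bij[OF that(1)] that(2) by (simp add: bij_betw_def)
    thus "f x (g x w) = w" "g x w \<in> vecs M x" unfolding g_def by (rule f_inv_into_f, rule inv_into_into)
  qed
  have lin: "lin (space_at M x) (space_at N x) (f x)" if "x \<in> {1..n}" for x
    using f that by (simp add: rep_mor_def)
  have "rep_mor n N M g" unfolding rep_mor_def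
  proof (intro conjI ballI)
    fix x assume x: "x \<in> {1..n}"
    note D = linD[OF lin[OF x]]
    note V = vspace_simps[OF D(1)]
    show "lin (space_at N x) (space_at M x) (g x)"
    proof (rule linI[OF D(2,1) g_in[OF x]])
      fix u v assume u: "u \<in> vecs N x" and v: "v \<in> vecs N x"
      note gu = g_in[OF x u] and gv = g_in[OF x v]
      have "u \<oplus>\<^bsub>space_at N x\<^esub> v = f x (g x u \<oplus>\<^bsub>space_at M x\<^esub> g x v)"
        using D(4)[OF gu gv] fg[OF x u] fg[OF x v] by simp
      thus "g x (u \<oplus>\<^bsub>space_at N x\<^esub> v) = g x u \<oplus>\<^bsub>space_at M x\<^esub> g x v"
        using gf[OF x V(2)[OF gu gv]] by simp
    next
      fix a u assume u: "u \<in> vecs N x"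
      note gu = g_in[OF x u]
      have "a \<odot>\<^bsub>space_at N x\<^esub> u = f x (a \<odot>\<^bsub>space_at M x\<^esub> g x u)"
        using D(5)[OF gu] fg[OF x u] by simp
      thus "g x (a \<odot>\<^bsub>space_at N x\<^esub> u) = a \<odot>\<^bsub>space_at M x\<^esub> g x u"
        using gf[OF x V(3)[OF gu]] by simp
    qed
  next
    fix x w assume x: "x \<in> {1..<n}" and w: "w \<in> vecs N x"
    hence x': "x \<in> {1..n}" "x + 1 \<in> {1..n}" by auto
    note gw = g_in[OF x'(1) w]
    have "lin (space_at M x) (space_at M (x + 1)) (arrow M x)" using M x by (simp add: is_rep_def)
    from linD(3)[OF this gw] have a: "arrow M x (g x w) \<in> vecs M (x + 1)" .
    have "f (x + 1) (arrow M x (g x w)) = arrow N x w"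
      using f x gw fg[OF x'(1) w] by (simp add: rep_mor_def)
    thus "g (x + 1) (arrow N x w) = arrow M x (g x w)" using gf[OF x'(2) a] by simp
  qed
  thus ?thesis unfolding rep_iso_def using f gf fg by blast
qed

abbreviation valid_bars :: "nat \<Rightarrow> (nat \<times> nat) multiset \<Rightarrow> bool" where
  "valid_bars n B \<equiv> \<forall>(b, d)\<in>#B. 1 \<le> b \<and> b \<le> d \<and> d \<le> n"

lemma valid_barsD:
  assumes "valid_bars n B" "j \<in> copies B"
  shows "1 \<le> fst (fst j)" "fst (fst j) \<le> snd (fst j)" "snd (fst j) \<le> n"
proof -
  obtain b d i where j: "j = ((b, d), i)" by (metis prod.collapse)
  have "i < count B (b, d)" using assms(2) by (simp add: copies_def j)
  hence "(b, d) \<in># B" by (metis count_greater_zero_iff not_less_zero gr0I)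
  thus "1 \<le> fst (fst j)" "fst (fst j) \<le> snd (fst j)" "snd (fst j) \<le> n" using assms(1) by (auto simp: j)
qed

text \<open>
The coordinates of a vector, collected into a function on the bars, form an element of the direct
sum.
\<close>

lemma bar_coordinates_imp_iso:
  fixes M :: "('k::field, 'v) rep"
  assumes M: "is_rep n M" and l: "bar_coordinates (zero_extension n M) B l"
  shows "isomorphic_reps n M (interval_sum B)"
proof -
  let ?S = "interval_sum B :: ('k, (nat \<times> nat) \<times> nat \<Rightarrow> 'k) rep"
  note L = bar_coordinatesD[OF l]
  define f where "f x v = (\<lambda>j\<in>copies B. l x j v)" for x v
  have sp: "space_at (zero_extension n M) x = space_at M x" if "x \<in> {1..n}" for x
    using that by (simp add: zero_extension_inside)
  have V: "vspace (space_at M x)" if "x \<in> {1..n}" for x using M that by (simp add: is_rep_def)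
  have in_S: "f x v \<in> vecs ?S x" if "x \<in> {1..n}" "v \<in> vecs M x" for x v
    unfolding interval_sum_simps using L(2)[of _ x v] that sp by (auto simp: f_def)
  have lin: "lin (space_at M x) (space_at ?S x) (f x)" if x: "x \<in> {1..n}" for x
  proof (rule linI[OF V[OF x] interval_sum_vspace in_S[OF x]])
    have fn: "functional (space_at M x) (l x j)" if "j \<in> copies B" for j using L(1)[OF that, of x] sp[OF x] by simp
    show "f x (u \<oplus>\<^bsub>space_at M x\<^esub> v) = f x u \<oplus>\<^bsub>space_at ?S x\<^esub> f x v"
      if "u \<in> vecs M x" "v \<in> vecs M x" for u v
      unfolding interval_sum_simps f_def using fn that by (intro restrict_ext) (simp add: functional_def)
    show "f x (a \<odot>\<^bsub>space_at M x\<^esub> u) = a \<odot>\<^bsub>space_at ?S x\<^esub> f x u"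
      if "u \<in> vecs M x" for u a
      unfolding interval_sum_simps f_def using fn that by (intro restrict_ext) (simp add: functional_def)
  qed
  have "rep_mor n M ?S f"
    unfolding rep_mor_def
  proof (intro conjI ballI lin)
    fix x v assume x: "x \<in> {1..<n}" and v: "v \<in> vecs M x"
    have ar: "arrow (zero_extension n M) x = arrow M x" using x by (simp add: zero_extension_inside)
    have v': "v \<in> vecs (zero_extension n M) x" using v x sp[of x] by simp
    show "f (x + 1) (arrow M x v) = arrow ?S x (f x v)"
      unfolding interval_sum_simps f_def
      using L(5)[OF v'] ar by (intro restrict_ext) simp
  qed
  moreover have "bij_betw (f x) (vecs M x) (vecs ?S x)" if x: "x \<in> {1..n}" for x
    unfolding bij_betw_def
  proof (intro conjI subset_antisym subsetI)
    interpret linear_map class_ring "space_at M x" "space_at ?S x" "f x" by (rule lin[OF x])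
    have "v = zero_at M x" if "v \<in> vecs M x" and fv: "f x v = zero_at ?S x" for v
    proof -
      have "l x j v = 0" if j: "j \<in> copies B" for j
        using fun_cong[OF fv, of j] j unfolding interval_sum_simps f_def by simp
      thus ?thesis using L(3)[of v x] that(1) sp[OF x] by simp
    qed
    hence "ker = {zero_at M x}" unfolding ker_def using vspace_simps(1)[OF V[OF x]] linD(6)[OF lin[OF x]] by blast
    thus "inj_on (f x) (vecs M x)" by (intro Ke0_imp_inj) simp
  next
    fix w assume w: "w \<in> vecs ?S x"
    obtain v where v: "v \<in> vecs M x" "\<forall>j\<in>copies B. alive x j \<longrightarrow> l x j v = w j"
      using L(4)[of x w] sp[OF x] by auto
    have "f x v = w"
      unfolding f_def
    proof (rule PiE_ext[OF _ w[unfolded interval_sum_simps]])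
      show "(\<lambda>j\<in>copies B. l x j v) \<in> (\<Pi>\<^sub>E j\<in>copies B. if alive x j then UNIV else {0})"
        using in_S[OF x v(1)] unfolding interval_sum_simps f_def .
      fix j assume j: "j \<in> copies B"
      show "(\<lambda>j\<in>copies B. l x j v) j = w j"
      proof (cases "alive x j")
        case True
        thus ?thesis using v(2) j by simp
      next
        case False
        hence "w j = 0" using w j unfolding interval_sum_simps by (auto dest: PiE_mem)
        thus ?thesis using L(2)[OF j False, of v] v(1) sp[OF x] j by simp
      qed
    qed
    thus "w \<in> f x ` vecs M x" using v(1) by blast
  next
    fix w assume "w \<in> f x ` vecs M x"
    thus "w \<in> vecs ?S x" using in_S[OF x] by blast
  qed
  ultimately show ?thesis unfolding isomorphic_reps_def using rep_isoI M by blast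
qed

text \<open>
At the vertices \<open>1, \<dots>, n\<close> the coordinates are the components of the isomorphism. Elsewhere the space
is zero and, the bars being valid, none of them is alive, so the zero functionals serve.
\<close>

lemma iso_imp_bar_coordinates:
  fixes M :: "('k::field, 'v) rep"
  assumes M: "is_rep n M" and B: "valid_bars n B" and iso: "isomorphic_reps n M (interval_sum B)"
  shows "\<exists>l. bar_coordinates (zero_extension n M) B l"
proof -
  let ?S = "interval_sum B :: ('k, (nat \<times> nat) \<times> nat \<Rightarrow> 'k) rep"
  obtain f g where f: "rep_mor n M ?S f" and g: "rep_mor n ?S M g"
    and gf: "\<And>x v. x \<in> {1..n} \<Longrightarrow> v \<in> vecs M x \<Longrightarrow> g x (f x v) = v"
    and fg: "\<And>x w. x \<in> {1..n} \<Longrightarrow> w \<in> vecs ?S x \<Longrightarrow> f x (g x w) = w"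
    using iso unfolding isomorphic_reps_def rep_iso_def by blast
  have lf: "lin (space_at M x) (space_at ?S x) (f x)"
    and lg: "lin (space_at ?S x) (space_at M x) (g x)" if "x \<in> {1..n}" for x
    using f g that by (auto simp: rep_mor_def)
  define l where "l x j v = (if x \<in> {1..n} then f x v j else 0)" for x j v
  have l_out: "l x j v = 0" if "x \<notin> {1..n}" for x j v using that unfolding l_def by (rule if_not_P)
  let ?Z = "zero_extension n M"
  have out: "\<not> alive x j" if "x \<notin> {1..n}" "j \<in> copies B" for x j
    using valid_barsD[OF B that(2)] that(1) by (auto simp: alive_def)
  have sp: "space_at ?Z x = space_at M x" if "x \<in> {1..n}" for x
    using that by (simp add: zero_extension_inside)
  have spo: "space_at ?Z x = zero_space" if "x \<notin> {1..n}" for x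
    by (rule zero_extension_outside) (use that in auto)
  have fS: "f x v \<in> (\<Pi>\<^sub>E j\<in>copies B. if alive x j then UNIV else {0})" if "x \<in> {1..n}" "v \<in> vecs M x" for x v
    using linD(3)[OF lf[OF that(1)] that(2)] unfolding interval_sum_simps .
  have dead: "l x j v = 0" if j: "j \<in> copies B" "\<not> alive x j" and v: "v \<in> vecs ?Z x" for x j v
  proof (cases "x \<in> {1..n}")
    case True
    thus ?thesis using PiE_mem[OF fS[OF True, of v] j(1)] j(2) v sp[OF True] by (simp add: l_def)
  qed (rule l_out)
  have "bar_coordinates ?Z B l"
    unfolding bar_coordinates_def
  proof (intro conjI allI ballI impI dead)
    fix x j assume j: "j \<in> copies B"
    show "functional (space_at ?Z x) (l x j)"
    proof (cases "x \<in> {1..n}")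
      case True
      show ?thesis unfolding functional_def sp[OF True] l_def
        using linD(4,5)[OF lf[OF True]] True j unfolding interval_sum_simps by simp
    qed (simp add: functional_def l_out)
  next
    fix x v assume v: "v \<in> vecs ?Z x" and 0: "\<forall>j\<in>copies B. l x j v = 0"
    show "v = zero_at ?Z x"
    proof (cases "x \<in> {1..n}")
      case True
      have vM: "v \<in> vecs M x" using v sp[OF True] by simp
      have "f x v = zero_at ?S x"
        unfolding interval_sum_simps
      proof (rule extensionalityI[of _ "copies B"])
        show "f x v \<in> extensional (copies B)" using fS[OF True vM] unfolding PiE_def by blast
        show "f x v j = (\<lambda>j\<in>copies B. 0) j" if "j \<in> copies B" for j
          using bspec[OF 0 that] True that by (simp add: l_def)
      qed simp
      hence "v = g x (zero_at ?S x)" using gf[OF True vM] by simp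
      thus ?thesis using linD(6)[OF lg[OF True]] sp[OF True] by simp
    next
      case False
      show ?thesis using v unfolding spo[OF False] zero_space_def by simp
    qed
  next
    fix x and c :: "(nat \<times> nat) \<times> nat \<Rightarrow> 'k"
    show "\<exists>v\<in>vecs ?Z x. \<forall>j\<in>copies B. alive x j \<longrightarrow> l x j v = c j"
    proof (cases "x \<in> {1..n}")
      case True
      define w where "w = (\<lambda>j\<in>copies B. if alive x j then c j else 0)"
      have w: "w \<in> vecs ?S x" unfolding interval_sum_simps w_def by auto
      have "f x (g x w) j = c j" if "j \<in> copies B" "alive x j" for j
        unfolding fg[OF True w] using that by (simp add: w_def)
      thus ?thesis using linD(3)[OF lg[OF True] w] True sp[OF True]
        by (intro bexI[of _ "g x w"]) (simp_all add: l_def)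
    next
      case False
      have "zero_point \<in> vecs ?Z x" using spo[OF False] by (simp add: zero_space_def)
      moreover have "\<forall>j\<in>copies B. \<not> alive x j" using out[OF False] by simp
      ultimately show ?thesis by (intro bexI[of _ zero_point]) simp_all
    qed
  next
    fix x v j assume v: "v \<in> vecs ?Z x" and j: "j \<in> copies B"
    show "l (Suc x) j (arrow ?Z x v) = (if alive x j \<and> alive (Suc x) j then l x j v else 0)"
    proof (cases "x \<in> {1..<n}")
      case True
      hence xn: "x \<in> {1..n}" "Suc x \<in> {1..n}" by auto
      have ar: "arrow ?Z x = arrow M x" using True by (simp add: zero_extension_inside)
      have "v \<in> vecs M x" using v sp[OF xn(1)] by simp
      hence "f (Suc x) (arrow M x v) = arrow ?S x (f x v)"
        using f True by (simp add: rep_mor_def)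
      thus ?thesis using xn j by (simp add: l_def ar interval_sum_simps)
    next
      case False
      have edge: "\<not> (1 \<le> x \<and> Suc x \<le> n)" using False by auto
      have "arrow ?Z x v = zero_at ?Z (Suc x)" unfolding zero_extension_outside(2)[OF edge] ..
      moreover have "l (Suc x) j (zero_at ?Z (Suc x)) = 0"
      proof (cases "Suc x \<in> {1..n}")
        case True
        have "f (Suc x) (zero_at M (Suc x)) = (\<lambda>j\<in>copies B. 0)"
          using linD(6)[OF lf[OF True]] by (simp add: interval_sum_simps)
        thus ?thesis using j sp[OF True] by (simp add: l_def)
      qed (rule l_out)
      moreover have "\<not> (alive x j \<and> alive (Suc x) j)" using out[OF _ j, of x] out[OF _ j, of "Suc x"] False by fastforce
      ultimately show ?thesis by (simp only: if_False)
    qed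
  qed
  thus ?thesis by blast
qed


section \<open>Rank inequalities for interleaved modules\<close>

text \<open>
One of the two symmetric halves of an interleaving; the other one exchanges \<open>M\<close> with \<open>N\<close> and \<open>f\<close>
with \<open>g\<close>.
\<close>

definition half_interleaving ::
  "nat \<Rightarrow> ('k::field, 'v) rep \<Rightarrow> ('k, 'w) rep \<Rightarrow> (nat \<Rightarrow> 'v \<Rightarrow> 'w) \<Rightarrow> (nat \<Rightarrow> 'w \<Rightarrow> 'v) \<Rightarrow> bool" where
  "half_interleaving \<delta> M N f g \<longleftrightarrow>
     (\<forall>x. lin (space_at M x) (space_at N (x + \<delta>)) (f x)) \<and>
     (\<forall>x. \<forall>v\<in>vecs M x. f (Suc x) (arrow M x v) = arrow N (x + \<delta>) (f x v)) \<and>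
     (\<forall>x. \<forall>v\<in>vecs M x. g (x + \<delta>) (f x v) = path_map M x (2 * \<delta>) v)"

locale interleaved =
  fixes n \<delta> :: nat and M :: "('k::field, 'v) rep" and N :: "('k, 'w) rep" and f g
  assumes M: "persistence_module n M" and N: "persistence_module n N"
    and fg: "half_interleaving \<delta> M N f g" and gf: "half_interleaving \<delta> N M g f"
begin

lemmas PM = persistence_moduleD[OF M]
lemmas PN = persistence_moduleD[OF N]

lemma f_lin: "lin (space_at M x) (space_at N (x + \<delta>)) (f x)"
  and f_nat: "v \<in> vecs M x \<Longrightarrow> f (Suc x) (arrow M x v) = arrow N (x + \<delta>) (f x v)"
  and g_f: "v \<in> vecs M x \<Longrightarrow> g (x + \<delta>) (f x v) = path_map M x (2 * \<delta>) v"
  using fg unfolding half_interleaving_def by blast+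

lemma g_lin: "lin (space_at N x) (space_at M (x + \<delta>)) (g x)"
  and f_g: "w \<in> vecs N x \<Longrightarrow> f (x + \<delta>) (g x w) = path_map N x (2 * \<delta>) w"
  using gf unfolding half_interleaving_def by blast+

lemma f_path:
  assumes "v \<in> vecs M x"
  shows "f (x + k) (path_map M x k v) = path_map N (x + \<delta>) k (f x v)"
proof (induction k)
  case (Suc k)
  have "path_map M x k v \<in> vecs M (x + k)" by (rule linD(3)[OF path_map_lin[OF M] assms])
  from f_nat[OF this] Suc show ?case by (simp add: ac_simps)
qed simp

text \<open>
The image of \<open>f\<close> is the submodule of \<open>N(\<delta>)\<close> with space \<open>f\<^sub>d(M\<^sub>d)\<close> at \<open>d\<close>; the part of it that is
born at \<open>b\<close> or earlier is \<open>img b d\<close>, and \<open>rI\<close> is the rank function.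
\<close>

definition img :: "nat \<Rightarrow> nat \<Rightarrow> 'w set" where
  "img b d = f d ` image_at M b d"

abbreviation rM :: "nat \<Rightarrow> nat \<Rightarrow> nat" where "rM b d \<equiv> vdim (restr (space_at M d) (image_at M b d))"
abbreviation rN :: "nat \<Rightarrow> nat \<Rightarrow> nat" where "rN b d \<equiv> vdim (restr (space_at N d) (image_at N b d))"
definition rI :: "nat \<Rightarrow> nat \<Rightarrow> nat" where "rI b d = vdim (restr (space_at N (d + \<delta>)) (img b d))"

lemma img_subsp: "b \<le> d \<Longrightarrow> subsp (space_at N (d + \<delta>)) (img b d)"
  unfolding img_def by (rule image_subsp[OF f_lin image_at_subsp[OF M]])

lemma img_conv:
  assumes "b \<le> d"
  shows "img b d = path_map N (b + \<delta>) (d - b) ` f b ` vecs M b"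
proof -
  have "f d (path_map M b (d - b) v) = path_map N (b + \<delta>) (d - b) (f b v)" if "v \<in> vecs M b" for v
    using f_path[OF that, of "d - b"] assms by simp
  thus ?thesis unfolding img_def image_at_def image_image by (rule image_cong[OF refl])
qed

lemma arrow_img:
  assumes "b \<le> d" shows "arrow N (d + \<delta>) ` img b d = img b (Suc d)"
  using assms by (simp add: img_conv image_image Suc_diff_le add.commute[of \<delta> d])

lemma image_at_mono:
  assumes L: "persistence_module n L" and "b' \<le> b" "b \<le> d"
  shows "image_at L b' d \<subseteq> image_at L b d"
proof
  fix w assume "w \<in> image_at L b' d"
  then obtain v where v: "v \<in> vecs L b'" "w = path_map L b' (d - b') v" by (auto simp: image_at_def)
  have "w = path_map L b (d - b) (path_map L b' (b - b') v)"
    using path_map_add[of L b' "b - b'" "d - b" v] v(2) assms by simp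
  moreover have "path_map L b' (b - b') v \<in> vecs L b"
    using linD(3)[OF path_map_lin[OF L, of b' "b - b'"] v(1)] assms by simp
  ultimately show "w \<in> image_at L b d" by (simp add: image_at_def)
qed

lemma arrow_image_at:
  assumes "b \<le> d" shows "arrow L d ` image_at L b d = image_at L b (Suc d)"
  using assms by (simp add: image_at_def image_image Suc_diff_le)

text \<open>
For fixed \<open>d\<close>, the difference of the ranks at \<open>b\<close> and \<open>b'\<close> counts the bars alive at \<open>d\<close> and born
in the interval from \<open>b' + 1\<close> to \<open>b\<close>. As \<open>f\<^sub>d\<close> maps \<open>M\<^sub>d\<close> onto the image, the image of \<open>f\<close> has at
most as many of these as \<open>M\<close>.
\<close>

lemma rank_epi:
  assumes "b' \<le> b" "b \<le> d" shows "rI b d + rM b' d \<le> rM b d + rI b' d"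
  unfolding rI_def img_def
  using assms image_at_subsp[OF M]
  by (intro frobenius_inequality[OF f_lin] subsp_fin_dim[OF PM(1)] image_at_mono[OF M]) simp_all

text \<open>
Conversely \<open>g\<close> maps the image of \<open>f\<close> at \<open>d\<close> onto the image of the transition to \<open>d + 2\<delta>\<close>, so that
bars of \<open>M\<close> that live \<open>2\<delta>\<close> longer are visible in the image of \<open>f\<close>.
\<close>

lemma rank_epi':
  assumes "b' \<le> b" "b \<le> d" shows "rM b (d + 2 * \<delta>) + rI b' d \<le> rI b d + rM b' (d + 2 * \<delta>)"
proof -
  have g: "lin (space_at N (d + \<delta>)) (space_at M (d + 2 * \<delta>)) (g (d + \<delta>))"
    using g_lin[of "d + \<delta>"] by (simp add: mult_2 add.assoc)
  have img: "g (d + \<delta>) ` img c d = image_at M c (d + 2 * \<delta>)" if "c \<le> d" for c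
  proof -
    have "g (d + \<delta>) (f d (path_map M c (d - c) v)) = path_map M c (d + 2 * \<delta> - c) v" if v: "v \<in> vecs M c" for v
    proof -
      have "path_map M c (d - c) v \<in> vecs M d"
        using linD(3)[OF path_map_lin[OF M, of c "d - c"] v] \<open>c \<le> d\<close> by simp
      thus ?thesis using g_f path_map_add[of M c "d - c" "2 * \<delta>" v] \<open>c \<le> d\<close> by simp
    qed
    thus ?thesis unfolding img_def image_at_def image_image by (rule image_cong[OF refl])
  qed
  have "vdim (restr (space_at M (d + 2 * \<delta>)) (g (d + \<delta>) ` img b d)) + rI b' d \<le>
      rI b d + vdim (restr (space_at M (d + 2 * \<delta>)) (g (d + \<delta>) ` img b' d))"
    unfolding rI_def
  proof (rule frobenius_inequality[OF g])
    show "img b' d \<subseteq> img b d" unfolding img_def by (rule image_mono[OF image_at_mono[OF M assms]])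
  qed (use assms img_subsp subsp_fin_dim[OF PN(1)] in simp_all)
  thus ?thesis using img assms by simp
qed

text \<open>
Dually, for fixed \<open>b\<close> the drop of the rank from \<open>d\<close> to \<open>d + 1\<close> counts the bars that die at \<open>d\<close> and
are born at \<open>b\<close> or earlier. The image of \<open>f\<close> is contained in \<open>N(\<delta>)\<close> and has at most as many.
\<close>

lemma rank_mono:
  assumes "b \<le> d"
  shows "rI b d + rN (b + \<delta>) (Suc (d + \<delta>)) \<le> rN (b + \<delta>) (d + \<delta>) + rI b (Suc d)"
proof -
  have "img b d \<subseteq> image_at N (b + \<delta>) (d + \<delta>)"
    unfolding img_conv[OF assms] image_at_def using linD(3)[OF f_lin[of b]] by auto
  hence "vdim (restr (space_at N (Suc (d + \<delta>))) (arrow N (d + \<delta>) ` image_at N (b + \<delta>) (d + \<delta>))) + rI b d \<le>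
      rN (b + \<delta>) (d + \<delta>) + vdim (restr (space_at N (Suc (d + \<delta>))) (arrow N (d + \<delta>) ` img b d))"
    unfolding rI_def
    by (intro frobenius_inequality[OF PN(3)] subsp_fin_dim[OF PN(1)] image_at_subsp[OF N] img_subsp)
       (use assms in simp_all)
  thus ?thesis using assms arrow_image_at[of "b + \<delta>" "d + \<delta>" N] arrow_img[OF assms]
    by (simp add: rI_def)
qed

text \<open>
The transition of \<open>N\<close> from \<open>c\<close> to \<open>c + 2\<delta>\<close> factors through \<open>f\<close>, so vectors of \<open>N\<close> born by \<open>c\<close> lie
in the image of \<open>f\<close> once they are \<open>2\<delta>\<close> old. Bars of \<open>N\<close> born early enough thus occur in the image.
\<close>

lemma rank_mono':
  assumes "c + \<delta> \<le> d"
  shows "rN c (d + \<delta>) + rI (c + \<delta>) (Suc d) \<le> rI (c + \<delta>) d + rN c (Suc (d + \<delta>))"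
proof -
  \<comment> \<open>The transition from \<open>c\<close> to \<open>d + \<delta>\<close> passes through \<open>c + 2\<delta>\<close>, where \<open>f \<circ> g\<close> is available.\<close>
  have sub: "image_at N c (d + \<delta>) \<subseteq> img (c + \<delta>) d"
  proof
    fix u assume "u \<in> image_at N c (d + \<delta>)"
    then obtain w where w: "w \<in> vecs N c" "u = path_map N c (d + \<delta> - c) w" by (auto simp: image_at_def)
    have "d + \<delta> - c = 2 * \<delta> + (d - (c + \<delta>))" using assms by simp
    hence "u = path_map N (c + \<delta> + \<delta>) (d - (c + \<delta>)) (f (c + \<delta>) (g c w))"
      using path_map_add[of N c "2 * \<delta>" "d - (c + \<delta>)" w] f_g[OF w(1)] w(2) by (simp add: mult_2 add.assoc)
    thus "u \<in> img (c + \<delta>) d"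
      unfolding img_conv[OF assms] using linD(3)[OF g_lin w(1)] by blast
  qed
  have "vdim (restr (space_at N (Suc (d + \<delta>))) (arrow N (d + \<delta>) ` img (c + \<delta>) d)) + rN c (d + \<delta>) \<le>
      rI (c + \<delta>) d + vdim (restr (space_at N (Suc (d + \<delta>))) (arrow N (d + \<delta>) ` image_at N c (d + \<delta>)))"
    unfolding rI_def
    by (intro frobenius_inequality[OF PN(3)] subsp_fin_dim[OF PN(1)] image_at_subsp[OF N] img_subsp sub)
       (use assms in simp_all)
  thus ?thesis using assms arrow_image_at[of c "d + \<delta>" N] arrow_img[OF assms]
    by (simp add: rI_def)
qed

text \<open>
The multiplicities that inclusion-exclusion attaches to the rank function of the image are
nonnegative.
\<close>

lemma rank_convex:
  assumes "b' \<le> b" "b \<le> d"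
  shows "rI b' d + rI b (Suc d) \<le> rI b d + rI b' (Suc d)"
proof -
  have "img b' d \<subseteq> img b d" unfolding img_def by (rule image_mono[OF image_at_mono[OF M assms]])
  hence "vdim (restr (space_at N (Suc (d + \<delta>))) (arrow N (d + \<delta>) ` img b d)) + rI b' d \<le>
      rI b d + vdim (restr (space_at N (Suc (d + \<delta>))) (arrow N (d + \<delta>) ` img b' d))"
    unfolding rI_def
    by (intro frobenius_inequality[OF PN(3)] subsp_fin_dim[OF PN(1)] img_subsp) (use assms in simp_all)
  thus ?thesis using assms arrow_img[of b d] arrow_img[of b' d] by (simp add: rI_def)
qed

lemma rI_trivial:
  assumes "b \<le> d" "b = 0 \<or> n < d" shows "rI b d = 0"
proof -
  have "img b d \<subseteq> {\<zero>\<^bsub>space_at N (d + \<delta>)\<^esub>}"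
  proof (cases "b = 0")
    case True
    hence "image_at M b d = {path_map M b (d - b) (zero_at M b)}" using PM(4)[of b] by (simp add: image_at_def)
    also have "\<dots> = {zero_at M d}" using linD(6)[OF path_map_lin[OF M, of b "d - b"]] assms(1) by simp
    finally show ?thesis using linD(6)[OF f_lin[of d]] by (simp add: img_def)
  next
    case False
    thus ?thesis using PN(4)[of "d + \<delta>"] assms(2) subspD(1)[OF img_subsp[OF assms(1)]] by simp
  qed
  hence "img b d = {\<zero>\<^bsub>space_at N (d + \<delta>)\<^esub>}" using subspD(2)[OF img_subsp[OF assms(1)]] by blast
  thus ?thesis unfolding rI_def
    using restr_vspace[OF PN(2) img_subsp[OF assms(1)]] by (intro dim_zero) simp_all
qed

end


section \<open>Matchings from counts\<close>

lemma descending_enumeration: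
  fixes key :: "'a \<Rightarrow> nat"
  assumes "finite S"
  shows "\<exists>e. bij_betw e {..<card S} S \<and>
    (\<forall>i<card S. \<forall>t. t \<le> key (e i) \<longleftrightarrow> i < card {s \<in> S. t \<le> key s})"
proof -
  obtain xs where xs: "set xs = S" "distinct xs" using finite_distinct_list[OF assms] by blast
  define ys where "ys = rev (sort_key key xs)"
  have ys: "set ys = S" "distinct ys" using xs by (simp_all add: ys_def)
  have len: "length ys = card S" using distinct_card[OF ys(2)] ys(1) by simp
  have desc: "key (ys ! j) \<le> key (ys ! i)" if "i \<le> j" "j < card S" for i j
  proof -
    have "sorted (map key (sort_key key xs))" by simp
    hence "sorted (rev (map key ys))" by (simp add: ys_def rev_map)
    moreover have "j < length (map key ys)" using that(2) len by simp
    ultimately have "map key ys ! j \<le> map key ys ! i" using that(1) by (intro sorted_rev_nth_mono)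
    thus ?thesis using that len by (simp only: nth_map le_less_trans)
  qed
  have bij: "bij_betw ((!) ys) {..<card S} S"
    by (rule bij_betw_nth[OF ys(2)]) (simp_all only: ys(1) len)
  have iff: "t \<le> key (ys ! i) \<longleftrightarrow> i < card {s \<in> S. t \<le> key s}" if i: "i < card S" for i t
  proof
    assume t: "t \<le> key (ys ! i)"
    have "(!) ys ` {..i} \<subseteq> {s \<in> S. t \<le> key s}"
    proof
      fix s assume "s \<in> (!) ys ` {..i}"
      then obtain j where "j \<le> i" "s = ys ! j" by auto
      moreover have "ys ! j \<in> S" using \<open>j \<le> i\<close> i len ys(1) nth_mem[of j ys] by simp
      moreover have "t \<le> key (ys ! j)" using desc[of j i] \<open>j \<le> i\<close> t i by simp
      ultimately show "s \<in> {s \<in> S. t \<le> key s}" by simp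
    qed
    hence "card ((!) ys ` {..i}) \<le> card {s \<in> S. t \<le> key s}" using assms by (intro card_mono) auto
    moreover have "card ((!) ys ` {..i}) = Suc i"
    proof (subst card_image)
      show "inj_on ((!) ys) {..i}"
        by (rule inj_on_subset[OF bij_betw_imp_inj_on[OF bij]]) (use i in auto)
    qed simp
    ultimately show "i < card {s \<in> S. t \<le> key s}" by simp
  next
    assume c: "i < card {s \<in> S. t \<le> key s}"
    show "t \<le> key (ys ! i)"
    proof (rule ccontr)
      assume n: "\<not> t \<le> key (ys ! i)"
      have "{s \<in> S. t \<le> key s} \<subseteq> (!) ys ` {..<i}"
      proof
        fix s assume s: "s \<in> {s \<in> S. t \<le> key s}"
        then obtain j where j: "j < card S" "s = ys ! j" using bij unfolding bij_betw_def by blast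
        have "\<not> i \<le> j" using desc[of i j] j s n by auto
        hence "j < i" by simp
        thus "s \<in> (!) ys ` {..<i}" using j(2) by blast
      qed
      hence "card {s \<in> S. t \<le> key s} \<le> card {..<i}" by (intro surj_card_le) simp_all
      thus False using c by simp
    qed
  qed
  show ?thesis using bij iff by blast
qed

text \<open>
Enumerate \<open>A\<close> and \<open>P\<close> in descending order of length and send the \<open>i\<close>-th element of \<open>A\<close> to the
\<open>i\<close>-th element of \<open>P\<close>. In such an enumeration the \<open>i\<close>-th length is at least \<open>t\<close> if and only if more
than \<open>i\<close> elements have length at least \<open>t\<close>, so that bounds on counts become bounds on lengths.
\<close>

lemma matching_from_counts:
  fixes lenA :: "'a \<Rightarrow> nat" and lenP :: "'b \<Rightarrow> nat"
  assumes fin: "finite A" "finite P"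
    and le: "\<And>t. card {a \<in> A. t \<le> lenA a} \<le> card {p \<in> P. t \<le> lenP p}"
    and ge: "\<And>t. card {p \<in> P. t + k \<le> lenP p} \<le> card {a \<in> A. t \<le> lenA a}"
  shows "\<exists>h. inj_on h A \<and> h ` A \<subseteq> P \<and>
    (\<forall>a\<in>A. lenA a \<le> lenP (h a) \<and> lenP (h a) \<le> lenA a + k) \<and>
    (\<forall>p\<in>P. k \<le> lenP p \<longrightarrow> p \<in> h ` A)"
proof -
  obtain eA where eA: "bij_betw eA {..<card A} A"
    and A0: "\<forall>i<card A. \<forall>t. t \<le> lenA (eA i) \<longleftrightarrow> i < card {a \<in> A. t \<le> lenA a}"
    using descending_enumeration[OF fin(1), of lenA] by blast
  obtain eP where eP: "bij_betw eP {..<card P} P"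
    and P0: "\<forall>i<card P. \<forall>t. t \<le> lenP (eP i) \<longleftrightarrow> i < card {p \<in> P. t \<le> lenP p}"
    using descending_enumeration[OF fin(2), of lenP] by blast
  have A: "t \<le> lenA (eA i) \<longleftrightarrow> i < card {a \<in> A. t \<le> lenA a}" if "i < card A" for i t
    using A0 that by blast
  have P: "t \<le> lenP (eP i) \<longleftrightarrow> i < card {p \<in> P. t \<le> lenP p}" if "i < card P" for i t
    using P0 that by blast
  define ix where "ix = inv_into {..<card A} eA"
  have ix: "ix a < card A" "eA (ix a) = a" if "a \<in> A" for a
  proof -
    have "a \<in> eA ` {..<card A}" using bij_betw_imp_surj_on[OF eA] that by simp
    thus "ix a < card A" "eA (ix a) = a"
      unfolding ix_def using inv_into_into[of a eA "{..<card A}"] f_inv_into_f[of a eA "{..<card A}"]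
      by simp_all
  qed
  have ix_e: "ix (eA i) = i" if "i < card A" for i
    unfolding ix_def by (rule inv_into_f_f[OF bij_betw_imp_inj_on[OF eA]]) (use that in simp)
  have cAP: "card A \<le> card P" using le[of 0] by simp
  define h where "h a = eP (ix a)" for a
  have "inj_on h A"
  proof (rule inj_onI)
    fix a a' assume a: "a \<in> A" "a' \<in> A" "h a = h a'"
    have "ix a \<in> {..<card P}" "ix a' \<in> {..<card P}"
      using ix(1)[OF a(1)] ix(1)[OF a(2)] cAP by simp_all
    hence eq: "ix a = ix a'"
      by (rule inj_onD[OF bij_betw_imp_inj_on[OF eP] a(3)[unfolded h_def]])
    have "a = eA (ix a)" by (rule ix(2)[OF a(1), symmetric])
    also have "\<dots> = a'" unfolding eq by (rule ix(2)[OF a(2)])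
    finally show "a = a'" .
  qed
  moreover have "h ` A \<subseteq> P"
  proof
    fix p assume "p \<in> h ` A"
    then obtain a where a: "a \<in> A" "p = eP (ix a)" unfolding h_def by blast
    have "ix a \<in> {..<card P}" using ix(1)[OF a(1)] cAP by simp
    thus "p \<in> P" unfolding a(2) by (rule bij_betw_apply[OF eP])
  qed
  moreover have "lenA a \<le> lenP (h a) \<and> lenP (h a) \<le> lenA a + k" if a: "a \<in> A" for a
  proof
    note i = ix[OF a]
    have iP: "ix a < card P" using i cAP by simp
    have "ix a < card {x \<in> A. lenA a \<le> lenA x}" by (rule iffD1[OF A[OF i(1)]]) (simp add: i(2))
    also have "\<dots> \<le> card {p \<in> P. lenA a \<le> lenP p}" by (rule le)
    finally show "lenA a \<le> lenP (h a)" unfolding h_def by (rule iffD2[OF P[OF iP]])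
    show "lenP (h a) \<le> lenA a + k"
    proof (rule ccontr)
      assume "\<not> lenP (h a) \<le> lenA a + k"
      \<comment> \<open>Then more than \<open>ix a\<close> elements of \<open>A\<close> would be longer than \<open>a\<close>, which is only at position \<open>ix a\<close>.\<close>
      hence "Suc (lenA a) + k \<le> lenP (eP (ix a))" by (simp add: h_def)
      hence "ix a < card {p \<in> P. Suc (lenA a) + k \<le> lenP p}" by (rule iffD1[OF P[OF iP]])
      also have "\<dots> \<le> card {x \<in> A. Suc (lenA a) \<le> lenA x}" by (rule ge)
      finally have "Suc (lenA a) \<le> lenA (eA (ix a))" by (rule iffD2[OF A[OF i(1)]])
      thus False using i(2) by simp
    qed
  qed
  moreover have "p \<in> h ` A" if p: "p \<in> P" "k \<le> lenP p" for p
  proof -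
    have "p \<in> eP ` {..<card P}" using p(1) unfolding bij_betw_imp_surj_on[OF eP] .
    then obtain i where i: "i < card P" "p = eP i" by blast
    have "i < card {p \<in> P. 0 + k \<le> lenP p}"       by (rule iffD1[OF P[OF i(1)]]) (use i(2) p(2) in simp)
    also have "\<dots> \<le> card {a \<in> A. 0 \<le> lenA a}" by (rule ge)
    finally have "i < card A" by simp
    hence "eA i \<in> A" "h (eA i) = p" using bij_betw_apply[OF eA, of i] ix_e i(2) by (simp_all add: h_def)
    thus ?thesis by blast
  qed
  ultimately show ?thesis by blast
qed


abbreviation birth :: "(nat \<times> nat) \<times> nat \<Rightarrow> nat" where "birth j \<equiv> fst (fst j)"
abbreviation death :: "(nat \<times> nat) \<times> nat \<Rightarrow> nat" where "death j \<equiv> snd (fst j)"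

lemma finite_subset_copies: "finite {j \<in> copies B. P j}"
  by (rule finite_subset[OF _ finite_copies[of B]]) auto

lemma card_bars_born:
  "card {j \<in> copies B. birth j = Suc b \<and> e \<le> death j} + card (bars_over B b e) = card (bars_over B (Suc b) e)"
proof -
  have "bars_over B (Suc b) e = {j \<in> copies B. birth j = Suc b \<and> e \<le> death j} \<union> bars_over B b e"
    by (auto simp: bars_over_def)
  thus ?thesis
    by (simp add: bars_over_def) (subst card_Un_disjoint[symmetric]; auto intro: finite_subset_copies)
qed

lemma card_bars_dying:
  "card {j \<in> copies B. death j = d \<and> birth j \<le> s} + card (bars_over B s (Suc d)) = card (bars_over B s d)"
proof -
  have "bars_over B s d = {j \<in> copies B. death j = d \<and> birth j \<le> s} \<union> bars_over B s (Suc d)"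
    by (auto simp: bars_over_def)
  thus ?thesis
    by (simp add: bars_over_def) (subst card_Un_disjoint[symmetric]; auto intro: finite_subset_copies)
qed

text \<open>
The combinatorial content of an interleaving: two barcodes and the rank function \<open>r\<close> of a module
between them, the image of the interleaving morphism.
\<close>

locale bar_counts =
  fixes n \<delta> :: nat and B B' :: "(nat \<times> nat) multiset" and r :: "nat \<Rightarrow> nat \<Rightarrow> nat"
  assumes validB: "valid_bars n B" and validB': "valid_bars n B'"
    and epi: "Suc b \<le> d \<Longrightarrow> r (Suc b) d + card (bars_over B b d) \<le> card (bars_over B (Suc b) d) + r b d"
    and epi': "Suc b \<le> d \<Longrightarrow> card (bars_over B (Suc b) (d + 2 * \<delta>)) + r b d \<le>
      r (Suc b) d + card (bars_over B b (d + 2 * \<delta>))"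
    and mono: "b \<le> d \<Longrightarrow> r b d + card (bars_over B' (b + \<delta>) (Suc (d + \<delta>))) \<le>
      card (bars_over B' (b + \<delta>) (d + \<delta>)) + r b (Suc d)"
    and mono': "c + \<delta> \<le> d \<Longrightarrow> card (bars_over B' c (d + \<delta>)) + r (c + \<delta>) (Suc d) \<le>
      r (c + \<delta>) d + card (bars_over B' c (Suc (d + \<delta>)))"
    and convex: "Suc b \<le> d \<Longrightarrow> r b d + r (Suc b) (Suc d) \<le> r (Suc b) d + r b (Suc d)"
    and trivial: "b \<le> d \<Longrightarrow> b = 0 \<or> n < d \<Longrightarrow> r b d = 0"
begin

text \<open>
The multiplicity of the interval from \<open>b\<close> to \<open>d\<close> in a module with rank function \<open>r\<close>, by
inclusion-exclusion; the subtraction is exact by \<open>convex\<close>.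
\<close>

definition bar_mult :: "nat \<Rightarrow> nat \<Rightarrow> nat" where
  "bar_mult b d = (r b d + r (b - 1) (Suc d)) - (r (b - 1) d + r b (Suc d))"

text \<open>
The copies of the bars in the barcode of the image.
\<close>

definition middle :: "((nat \<times> nat) \<times> nat) set" where
  "middle = {((b, d), i). 1 \<le> b \<and> b \<le> d \<and> d \<le> n \<and> i < bar_mult b d}"

lemma middleD: "a \<in> middle \<Longrightarrow> 1 \<le> birth a \<and> birth a \<le> death a \<and> death a \<le> n"
  by (auto simp: middle_def)

lemma finite_middle: "finite {a \<in> middle. P a}"
proof (rule finite_subset)
  show "{a \<in> middle. P a} \<subseteq> (SIGMA (b, d):{..n} \<times> {..n}. {..<bar_mult b d})" by (auto simp: middle_def)
qed auto

lemma card_middle_point: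
  assumes "1 \<le> b" "b \<le> d" "d \<le> n"
  shows "card {a \<in> middle. birth a = b \<and> death a = d} = bar_mult b d"
proof -
  have "{a \<in> middle. birth a = b \<and> death a = d} = Pair (b, d) ` {..<bar_mult b d}"
    using assms by (auto simp: middle_def)
  thus ?thesis by (simp add: card_image inj_on_def)
qed

lemma bar_mult_Suc:
  assumes "Suc b \<le> d" shows "bar_mult (Suc b) d + (r b d + r (Suc b) (Suc d)) = r (Suc b) d + r b (Suc d)"
  using convex[OF assms] by (simp add: bar_mult_def)

text \<open>
The multiplicities telescope in the death coordinate, from \<open>n\<close> downwards.
\<close>

lemma card_middle_born:
  assumes "Suc b \<le> e"
  shows "card {a \<in> middle. birth a = Suc b \<and> e \<le> death a} + r b e = r (Suc b) e"
  using assms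
proof (induction "Suc n - e" arbitrary: e)
  case 0
  hence "{a \<in> middle. birth a = Suc b \<and> e \<le> death a} = {}" using middleD by fastforce
  thus ?case using trivial[of b e] trivial[of "Suc b" e] 0 by (simp only: card.empty) simp
next
  case (Suc k)
  hence en: "e \<le> n" by simp
  have "{a \<in> middle. birth a = Suc b \<and> e \<le> death a} =
    {a \<in> middle. birth a = Suc b \<and> death a = e} \<union> {a \<in> middle. birth a = Suc b \<and> Suc e \<le> death a}" by auto
  hence "card {a \<in> middle. birth a = Suc b \<and> e \<le> death a} =
    card {a \<in> middle. birth a = Suc b \<and> death a = e} + card {a \<in> middle. birth a = Suc b \<and> Suc e \<le> death a}"
    by (simp only:) (rule card_Un_disjoint[OF finite_middle finite_middle], auto)
  moreover have "card {a \<in> middle. birth a = Suc b \<and> death a = e} = bar_mult (Suc b) e"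
    using card_middle_point[of "Suc b" e] Suc.prems en by simp
  moreover have "k = Suc n - Suc e" "Suc b \<le> Suc e" using Suc.hyps(2) Suc.prems by simp_all
  note Suc.hyps(1)[OF this]
  ultimately show ?case using bar_mult_Suc[OF Suc.prems] by linarith
qed

text \<open>
The multiplicities telescope in the birth coordinate, from \<open>0\<close> upwards.
\<close>

lemma card_middle_dying:
  assumes "s \<le> d" "d \<le> n"
  shows "card {a \<in> middle. death a = d \<and> birth a \<le> s} + r s (Suc d) = r s d"
  using assms(1)
proof (induction s)
  case 0
  have "{a \<in> middle. death a = d \<and> birth a \<le> 0} = {}" using middleD by fastforce
  thus ?case using trivial[of 0 d] trivial[of 0 "Suc d"] by (simp only: card.empty) simp
next
  case (Suc s)
  have "{a \<in> middle. death a = d \<and> birth a \<le> Suc s} =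
    {a \<in> middle. birth a = Suc s \<and> death a = d} \<union> {a \<in> middle. death a = d \<and> birth a \<le> s}" by auto
  hence "card {a \<in> middle. death a = d \<and> birth a \<le> Suc s} =
    card {a \<in> middle. birth a = Suc s \<and> death a = d} + card {a \<in> middle. death a = d \<and> birth a \<le> s}"
    by (simp only:) (rule card_Un_disjoint[OF finite_middle finite_middle], auto)
  also have "card {a \<in> middle. birth a = Suc s \<and> death a = d} = bar_mult (Suc s) d"
    using card_middle_point[of "Suc s" d] Suc.prems assms(2) by simp
  finally show ?case using bar_mult_Suc[OF Suc.prems] Suc.IH Suc.prems by simp
qed

abbreviation len :: "(nat \<times> nat) \<times> nat \<Rightarrow> nat" where "len j \<equiv> death j - birth j"

abbreviation matches :: "((nat \<times> nat) \<times> nat) set \<Rightarrow> ((nat \<times> nat) \<times> nat) set \<Rightarrow>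
    ((nat \<times> nat) \<times> nat \<Rightarrow> (nat \<times> nat) \<times> nat) \<Rightarrow> bool" where
  "matches A P h \<equiv> inj_on h A \<and> h ` A \<subseteq> P \<and>
    (\<forall>a\<in>A. len a \<le> len (h a) \<and> len (h a) \<le> len a + 2 * \<delta>) \<and> (\<forall>p\<in>P. 2 * \<delta> \<le> len p \<longrightarrow> p \<in> h ` A)"

text \<open>
Among bars with a common birth, those of length at least \<open>t\<close> are those that die at \<open>b + t\<close> or later;
the counts of both kinds of bars are differences of ranks, which \<open>epi\<close> and \<open>epi'\<close> compare.
\<close>

lemma match_births:
  "\<exists>h. matches {a \<in> middle. birth a = b} {j \<in> copies B. birth j = b} h"
proof (cases b)
  case 0
  have "{a \<in> middle. birth a = b} = {}" "{j \<in> copies B. birth j = b} = {}"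
    using middleD valid_barsD(1)[OF validB] 0 by fastforce+
  note empty = this
  show ?thesis unfolding empty by simp
next
  case (Suc c)
  have A: "{a \<in> {a \<in> middle. birth a = b}. t \<le> len a} = {a \<in> middle. birth a = Suc c \<and> b + t \<le> death a}" for t
    using middleD Suc by fastforce
  have P: "{j \<in> {j \<in> copies B. birth j = b}. t \<le> len j} = {j \<in> copies B. birth j = Suc c \<and> b + t \<le> death j}" for t
    using valid_barsD(2)[OF validB] Suc by fastforce
  show ?thesis
  proof (rule matching_from_counts[OF finite_middle finite_subset_copies], unfold A P)
    fix t
    have bt: "Suc c \<le> b + t" using Suc by simp
    show "card {a \<in> middle. birth a = Suc c \<and> b + t \<le> death a} \<le>
        card {j \<in> copies B. birth j = Suc c \<and> b + t \<le> death j}"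
      using card_middle_born[OF bt] card_bars_born[of B c "b + t"] epi[OF bt] by linarith
    have eq: "b + (t + 2 * \<delta>) = b + t + 2 * \<delta>" by simp
    show "card {j \<in> copies B. birth j = Suc c \<and> b + (t + 2 * \<delta>) \<le> death j} \<le>
        card {a \<in> middle. birth a = Suc c \<and> b + t \<le> death a}"
      unfolding eq
      using card_middle_born[OF bt] card_bars_born[of B c "b + t + 2 * \<delta>"] epi'[OF bt] by linarith
  qed
qed

text \<open>
Passing from \<open>N(\<delta>)\<close> to \<open>N\<close> moves the death from \<open>d\<close> to \<open>d + \<delta>\<close>. Lengths now measure how early a bar
is born, and the comparison is by \<open>mono\<close> and \<open>mono'\<close>.
\<close>

lemma match_deaths:
  "\<exists>h. matches {a \<in> middle. death a = d} {j \<in> copies B'. death j = d + \<delta>} h"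
proof (cases "d \<le> n")
  case False
  have "{a \<in> middle. death a = d} = {}" "{j \<in> copies B'. death j = d + \<delta>} = {}"
    using middleD valid_barsD(3)[OF validB'] False by fastforce+
  note empty = this
  show ?thesis unfolding empty by simp
next
  case True
  have A: "{a \<in> {a \<in> middle. death a = d}. t \<le> len a} = {a \<in> middle. death a = d \<and> birth a \<le> d - t}" for t
    using middleD by fastforce
  have P: "{j \<in> {j \<in> copies B'. death j = d + \<delta>}. t \<le> len j} =
      {j \<in> copies B'. death j = d + \<delta> \<and> birth j \<le> d + \<delta> - t}" for t
    using valid_barsD(1,2)[OF validB'] by fastforce
  show ?thesis
  proof (rule matching_from_counts[OF finite_middle finite_subset_copies], unfold A P)
    fix t
    have s: "d - t \<le> d" by simp
    note cA = card_middle_dying[OF s True]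
    show "card {a \<in> middle. death a = d \<and> birth a \<le> d - t} \<le>
        card {j \<in> copies B'. death j = d + \<delta> \<and> birth j \<le> d + \<delta> - t}"
    proof (cases "t \<le> d")
      case True
      hence "d + \<delta> - t = d - t + \<delta>" by simp
      thus ?thesis using cA card_bars_dying[of B' "d + \<delta>" "d - t + \<delta>"] mono[OF s] by simp
    next
      case False
      have "r (d - t) d = 0" by (rule trivial) (use False in simp_all)
      thus ?thesis using cA by simp
    qed
    show "card {j \<in> copies B'. death j = d + \<delta> \<and> birth j \<le> d + \<delta> - (t + 2 * \<delta>)} \<le>
        card {a \<in> middle. death a = d \<and> birth a \<le> d - t}"
    proof (cases "t + \<delta> \<le> d")
      case True
      hence c: "d + \<delta> - (t + 2 * \<delta>) = d - t - \<delta>" "d - t - \<delta> + \<delta> = d - t" by simp_all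
      have "d - t - \<delta> + \<delta> \<le> d" unfolding c(2) by simp
      from mono'[OF this] show ?thesis
        using cA card_bars_dying[of B' "d + \<delta>" "d - t - \<delta>"] unfolding c by linarith
    next
      case False
      hence "{j \<in> copies B'. death j = d + \<delta> \<and> birth j \<le> d + \<delta> - (t + 2 * \<delta>)} = {}"
        using valid_barsD(1)[OF validB'] by fastforce
      thus ?thesis by (simp only: card.empty)
    qed
  qed
qed

text \<open>
The maps for the single births glue to an injection \<open>H\<close> of the middle barcode into \<open>B\<close>, those for
the single deaths to an injection \<open>K\<close> into \<open>B'\<close>, and \<open>K \<circ> H\<^sup>-\<^sup>1\<close> is the matching. A middle bar
\<open>(b,d)\<close> goes to \<open>(b,e)\<close> with \<open>d \<le> e \<le> d + 2\<delta>\<close> and to \<open>(c,d+\<delta>)\<close> with \<open>b - \<delta> \<le> c \<le> b + \<delta>\<close>, whence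
the bounds on the endpoints.
\<close>

theorem exists_delta_matching: "\<exists>S S' \<sigma>. delta_matching \<delta> B B' S S' \<sigma>"
proof -
  have "\<exists>h. \<forall>b. matches {a \<in> middle. birth a = b} {j \<in> copies B. birth j = b} (h b)"
    by (intro choice allI match_births)
  then obtain h where h0: "\<forall>b. matches {a \<in> middle. birth a = b} {j \<in> copies B. birth j = b} (h b)" ..
  have "\<exists>k. \<forall>d. matches {a \<in> middle. death a = d} {j \<in> copies B'. death j = d + \<delta>} (k d)"
    by (intro choice allI match_deaths)
  then obtain k where k0: "\<forall>d. matches {a \<in> middle. death a = d} {j \<in> copies B'. death j = d + \<delta>} (k d)" ..
  note h = spec[OF h0] and k = spec[OF k0]
  define H where "H a = h (birth a) a" for a
  define K where "K a = k (death a) a" for a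
  have H: "H a \<in> copies B" "birth (H a) = birth a" "len a \<le> len (H a)" "len (H a) \<le> len a + 2 * \<delta>"
    if "a \<in> middle" for a
  proof -
    have a: "a \<in> {x \<in> middle. birth x = birth a}" using that by simp
    have "h (birth a) a \<in> {j \<in> copies B. birth j = birth a}" using h[of "birth a"] a by blast
    thus "H a \<in> copies B" "birth (H a) = birth a" by (simp_all add: H_def)
    show "len a \<le> len (H a)" "len (H a) \<le> len a + 2 * \<delta>" using h[of "birth a"] a unfolding H_def by blast+
  qed
  have K: "K a \<in> copies B'" "death (K a) = death a + \<delta>" "len a \<le> len (K a)" "len (K a) \<le> len a + 2 * \<delta>"
    if "a \<in> middle" for a
  proof -
    have a: "a \<in> {x \<in> middle. death x = death a}" using that by simp
    have "k (death a) a \<in> {j \<in> copies B'. death j = death a + \<delta>}" using k[of "death a"] a by blast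
    thus "K a \<in> copies B'" "death (K a) = death a + \<delta>" by (simp_all add: K_def)
    show "len a \<le> len (K a)" "len (K a) \<le> len a + 2 * \<delta>" using k[of "death a"] a unfolding K_def by blast+
  qed
  \<comment> \<open>As \<open>H\<close> preserves births, two bars with the same value have the same birth.\<close>
  have injH: "inj_on H middle"
  proof (rule inj_onI)
    fix a a' assume a: "a \<in> middle" "a' \<in> middle" and eq: "H a = H a'"
    have b: "birth a' = birth a" using H(2)[OF a(1)] H(2)[OF a(2)] eq by simp
    have "h (birth a) a = h (birth a) a'" using eq unfolding H_def b .
    moreover have "inj_on (h (birth a)) {x \<in> middle. birth x = birth a}" using h by blast
    ultimately show "a = a'" using a b by (elim inj_onD) simp_all
  qed
  have injK: "inj_on K middle"
  proof (rule inj_onI)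
    fix a a' assume a: "a \<in> middle" "a' \<in> middle" and eq: "K a = K a'"
    have b: "death a' = death a" using K(2)[OF a(1)] K(2)[OF a(2)] eq by simp
    have "k (death a) a = k (death a) a'" using eq unfolding K_def b .
    moreover have "inj_on (k (death a)) {x \<in> middle. death x = death a}" using k by blast
    ultimately show "a = a'" using a b by (elim inj_onD) simp_all
  qed
  define \<sigma> where "\<sigma> j = K (inv_into middle H j)" for j
  have \<sigma>: "\<sigma> (H a) = K a" if "a \<in> middle" for a
    unfolding \<sigma>_def inv_into_f_f[OF injH that] ..
  have "delta_matching \<delta> B B' (H ` middle) (K ` middle) \<sigma>"
    unfolding delta_matching_def
  proof (intro conjI)
    show "H ` middle \<subseteq> copies B" "K ` middle \<subseteq> copies B'" using H(1) K(1) by blast+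
    have "\<sigma> ` H ` middle = K ` middle" unfolding image_image by (rule image_cong[OF refl \<sigma>])
    moreover have "inj_on \<sigma> (H ` middle)"
    proof (rule inj_onI)
      fix p q assume pq: "p \<in> H ` middle" "q \<in> H ` middle" "\<sigma> p = \<sigma> q"
      then obtain a a' where a: "a \<in> middle" "a' \<in> middle" "p = H a" "q = H a'" by blast
      hence "K a = K a'" using pq(3) \<sigma> by simp
      hence "a = a'" using injK a(1,2) by (elim inj_onD)
      thus "p = q" using a by simp
    qed
    ultimately show "bij_betw \<sigma> (H ` middle) (K ` middle)" by (simp add: bij_betw_def)
    have "j \<in> H ` middle" if j: "j \<in> copies B" and long: "birth j + 2 * \<delta> \<le> death j" for j
    proof -
      have "2 * \<delta> \<le> len j" using long by simp
      moreover have "j \<in> {x \<in> copies B. birth x = birth j}" using j by simp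
      ultimately have "j \<in> h (birth j) ` {a \<in> middle. birth a = birth j}" using h[of "birth j"] by blast
      then obtain a where "a \<in> middle" "birth a = birth j" "j = h (birth j) a" by blast
      thus ?thesis by (intro image_eqI[of _ _ a]) (simp_all add: H_def)
    qed
    thus "\<forall>((b, d), j)\<in>copies B. b + 2 * \<delta> \<le> d \<longrightarrow> ((b, d), j) \<in> H ` middle" by fastforce
    have "j \<in> K ` middle" if j: "j \<in> copies B'" and long: "birth j + 2 * \<delta> \<le> death j" for j
    proof -
      have d: "death j = death j - \<delta> + \<delta>" using long by simp
      have "2 * \<delta> \<le> len j" using long by simp
      moreover have "j \<in> {x \<in> copies B'. death x = death j - \<delta> + \<delta>}" using j d by simp
      ultimately have "j \<in> k (death j - \<delta>) ` {a \<in> middle. death a = death j - \<delta>}"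
        using k[of "death j - \<delta>"] by blast
      then obtain a where "a \<in> middle" "death a = death j - \<delta>" "j = k (death j - \<delta>) a" by blast
      thus ?thesis by (intro image_eqI[of _ _ a]) (simp_all add: K_def)
    qed
    thus "\<forall>((b, d), j)\<in>copies B'. b + 2 * \<delta> \<le> d \<longrightarrow> ((b, d), j) \<in> K ` middle" by fastforce
    show "\<forall>b d j b' d' j'. ((b, d), j) \<in> H ` middle \<and> \<sigma> ((b, d), j) = ((b', d'), j') \<longrightarrow>
        b' \<le> b + \<delta> \<and> b \<le> d \<and> d \<le> d' + \<delta> \<and> b \<le> b' + \<delta> \<and> b' \<le> d' \<and> d' \<le> d + \<delta>"
    proof (intro allI impI)
      fix b d j b' d' j' assume as: "((b, d), j) \<in> H ` middle \<and> \<sigma> ((b, d), j) = ((b', d'), j')"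
      then obtain a where a: "a \<in> middle" "H a = ((b, d), j)" by (metis imageE)
      hence Ka: "K a = ((b', d'), j')" using \<sigma>[OF a(1)] as by simp
      have hb: "birth a = b" "death a - birth a \<le> d - b" "d - b \<le> death a - birth a + 2 * \<delta>"
        using H(2-4)[OF a(1)] unfolding a(2) by simp_all
      have kd: "d' = death a + \<delta>" "death a - birth a \<le> d' - b'" "d' - b' \<le> death a - birth a + 2 * \<delta>"
        using K(2-4)[OF a(1)] unfolding Ka by simp_all
      have "b \<le> d" using valid_barsD(2)[OF validB H(1)[OF a(1)]] unfolding a(2) by simp
      moreover have "b' \<le> d'" using valid_barsD(2)[OF validB' K(1)[OF a(1)]] unfolding Ka by simp
      moreover have "birth a \<le> death a" using middleD[OF a(1)] by simp
      ultimately show "b' \<le> b + \<delta> \<and> b \<le> d \<and> d \<le> d' + \<delta> \<and> b \<le> b' + \<delta> \<and> b' \<le> d' \<and> d' \<le> d + \<delta>"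
        using hb kd by linarith
    qed
  qed
  thus ?thesis by blast
qed

end


section \<open>Quotient spaces and cohomology\<close>

lemma coset_mem: "u \<in> W +>\<^bsub>V\<^esub> v \<longleftrightarrow> (\<exists>w\<in>W. u = w \<oplus>\<^bsub>V\<^esub> v)"
  by (auto simp: a_r_coset_def')

lemma set_add_mem: "u \<in> set_add V A B \<longleftrightarrow> (\<exists>a\<in>A. \<exists>b\<in>B. u = a \<oplus>\<^bsub>V\<^esub> b)"
  by (auto simp: set_add_def')

text \<open>
The sum with \<open>W'\<close> absorbs the image of \<open>W\<close>, so a linear map that sends \<open>W\<close> into \<open>W'\<close> acts on
cosets through representatives. Scalar multiplication is the case where \<open>T\<close> is a homothety.
\<close>

lemma coset_image:
  assumes T: "lin U V T" and W: "subsp U W" and W': "subsp V W'" and TW: "T ` W \<subseteq> W'" and v: "v \<in> carrier U"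
  shows "set_add V W' (T ` (W +>\<^bsub>U\<^esub> v)) = W' +>\<^bsub>V\<^esub> T v"
proof (rule Set.set_eqI)
  fix u
  note D = linD[OF T]
  have Tv: "T v \<in> carrier V" by (rule D(3)[OF v])
  show "u \<in> set_add V W' (T ` (W +>\<^bsub>U\<^esub> v)) \<longleftrightarrow> u \<in> W' +>\<^bsub>V\<^esub> T v"
  proof
    assume "u \<in> set_add V W' (T ` (W +>\<^bsub>U\<^esub> v))"
    then obtain w' w where w: "w' \<in> W'" "w \<in> W" "u = w' \<oplus>\<^bsub>V\<^esub> T (w \<oplus>\<^bsub>U\<^esub> v)"
      unfolding set_add_mem by (auto simp: coset_mem)
    have wU: "w \<in> carrier U" and wV: "w' \<in> carrier V" using w subspD(5)[OF W] subspD(5)[OF W'] by auto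
    have "u = (w' \<oplus>\<^bsub>V\<^esub> T w) \<oplus>\<^bsub>V\<^esub> T v"
      using w(3) D(4)[OF wU v] vspace_ac(1)[OF D(2) wV D(3)[OF wU] Tv] by simp
    moreover have "w' \<oplus>\<^bsub>V\<^esub> T w \<in> W'" using w TW by (intro subspD(3)[OF W']) auto
    ultimately show "u \<in> W' +>\<^bsub>V\<^esub> T v" unfolding coset_mem by blast
  next
    assume "u \<in> W' +>\<^bsub>V\<^esub> T v"
    then obtain w' where w: "w' \<in> W'" "u = w' \<oplus>\<^bsub>V\<^esub> T v" unfolding coset_mem by blast
    have "\<zero>\<^bsub>U\<^esub> \<oplus>\<^bsub>U\<^esub> v = v" by (rule vspace_simps(4)[OF D(1) v])
    hence "v \<in> W +>\<^bsub>U\<^esub> v" unfolding coset_mem using subspD(2)[OF W] by metis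
    thus "u \<in> set_add V W' (T ` (W +>\<^bsub>U\<^esub> v))" unfolding set_add_mem using w by blast
  qed
qed

lemma smult_lin:
  assumes V: "vspace V" shows "lin V V (\<lambda>v. a \<odot>\<^bsub>V\<^esub> v)"
proof (rule linI[OF V V vspace_simps(3)[OF V]])
  show "a \<odot>\<^bsub>V\<^esub> (u \<oplus>\<^bsub>V\<^esub> v) = a \<odot>\<^bsub>V\<^esub> u \<oplus>\<^bsub>V\<^esub> a \<odot>\<^bsub>V\<^esub> v" if "u \<in> carrier V" "v \<in> carrier V" for u v
    by (rule vspace_distrib(1)[OF V that])
  show "a \<odot>\<^bsub>V\<^esub> (b \<odot>\<^bsub>V\<^esub> u) = b \<odot>\<^bsub>V\<^esub> (a \<odot>\<^bsub>V\<^esub> u)" if "u \<in> carrier V" for b u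
    using vspace_distrib(3)[OF V that, of a b] vspace_distrib(3)[OF V that, of b a] by (simp add: mult.commute)
qed

context
  fixes V :: "('k::field, 'v) module" and W :: "'v set"
  assumes V: "vspace V" and W: "subsp V W"
begin

lemma quot_carrier: "carrier (quot_space V W) = (\<lambda>v. W +>\<^bsub>V\<^esub> v) ` carrier V"
  by (auto simp: quot_space_def A_RCOSETS_def')

lemma quot_add:
  assumes u: "u \<in> carrier V" and v: "v \<in> carrier V"
  shows "(W +>\<^bsub>V\<^esub> u) \<oplus>\<^bsub>quot_space V W\<^esub> (W +>\<^bsub>V\<^esub> v) = W +>\<^bsub>V\<^esub> (u \<oplus>\<^bsub>V\<^esub> v)"
proof -
  interpret vectorspace class_ring V by (rule V)
  have "additive_subgroup W V"
  proof (rule additive_subgroupI, rule M.add.subgroupI)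
    show "W \<subseteq> carrier V" "W \<noteq> {}" using subspD(1,2)[OF W] by auto
    show "w \<oplus>\<^bsub>V\<^esub> w' \<in> W" if "w \<in> W" "w' \<in> W" for w w' by (rule subspD(3)[OF W that])
    show "\<ominus>\<^bsub>V\<^esub> w \<in> W" if "w \<in> W" for w
      using smult_minus_1[OF subspD(5)[OF W that]] subspD(4)[OF W that] by metis
  qed
  then interpret abelian_subgroup W V by (intro abelian_subgroupI3 M.abelian_group_axioms)
  show ?thesis unfolding quot_space_def using a_rcos_sum[OF u v] by simp
qed

lemma quot_smult:
  assumes v: "v \<in> carrier V"
  shows "a \<odot>\<^bsub>quot_space V W\<^esub> (W +>\<^bsub>V\<^esub> v) = W +>\<^bsub>V\<^esub> (a \<odot>\<^bsub>V\<^esub> v)"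
  using coset_image[OF smult_lin[OF V, of a] W W _ v] subspD(4)[OF W] by (auto simp: quot_space_def)

lemma quot_zero: "\<zero>\<^bsub>quot_space V W\<^esub> = W +>\<^bsub>V\<^esub> \<zero>\<^bsub>V\<^esub>"
proof -
  have "w \<oplus>\<^bsub>V\<^esub> \<zero>\<^bsub>V\<^esub> = w" if "w \<in> W" for w using vspace_simps(5)[OF V subspD(5)[OF W that]] .
  hence "W +>\<^bsub>V\<^esub> \<zero>\<^bsub>V\<^esub> = W" unfolding set_eq_iff coset_mem by metis
  thus ?thesis by (simp add: quot_space_def)
qed

lemma quot_vspace: "vspace (quot_space V W)"
proof -
  note vs = vspace_simps[OF V] and vd = vspace_distrib[OF V]
  have ex_neg: "\<exists>w\<in>carrier (quot_space V W). (W +>\<^bsub>V\<^esub> v) \<oplus>\<^bsub>quot_space V W\<^esub> w = W +>\<^bsub>V\<^esub> \<zero>\<^bsub>V\<^esub>"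
    if v: "v \<in> carrier V" for v
  proof -
    have m: "(-1) \<odot>\<^bsub>V\<^esub> v \<in> carrier V" by (rule vs(3)[OF v])
    show ?thesis unfolding quot_carrier using quot_add[OF v m] vd(4)[OF v] m by (intro bexI[of _ "W +>\<^bsub>V\<^esub> ((-1) \<odot>\<^bsub>V\<^esub> v)"]) simp_all
  qed
  show ?thesis
  proof (rule vs_criteria[OF class_ring_field])
    show "\<zero>\<^bsub>quot_space V W\<^esub> \<in> carrier (quot_space V W)" unfolding quot_carrier quot_zero using vs(1) by blast
    show "\<forall>v\<in>carrier (quot_space V W). \<exists>w\<in>carrier (quot_space V W). v \<oplus>\<^bsub>quot_space V W\<^esub> w = \<zero>\<^bsub>quot_space V W\<^esub>"
      using ex_neg unfolding quot_zero by (subst (1) quot_carrier) blast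
  qed (auto simp: quot_carrier quot_zero quot_add quot_smult vs vd vspace_ac[OF V])
qed

lemma quot_lin: "lin V (quot_space V W) (\<lambda>v. W +>\<^bsub>V\<^esub> v)"
  by (rule linI[OF V quot_vspace]) (simp_all add: quot_carrier quot_add quot_smult)

lemma quot_fd:
  assumes "fd_space V" shows "fd_space (quot_space V W)"
proof -
  interpret linear_map class_ring V "quot_space V W" "\<lambda>v. W +>\<^bsub>V\<^esub> v" by (rule quot_lin)
  show ?thesis using surj_fin_dim quot_vspace assms quot_carrier by (simp add: fd_space_def)
qed

end

lemma quot_induced_lin:
  assumes T: "lin U V T" and W: "subsp U W" and W': "subsp V W'" and TW: "T ` W \<subseteq> W'"
  shows "lin (quot_space U W) (quot_space V W') (\<lambda>C. set_add V W' (T ` C))"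
proof -
  note D = linD[OF T]
  note ci = coset_image[OF T W W' TW]
  note QU = quot_carrier[OF D(1) W] quot_add[OF D(1) W] quot_smult[OF D(1) W]
  note QV = quot_carrier[OF D(2) W'] quot_add[OF D(2) W'] quot_smult[OF D(2) W']
  show ?thesis
  proof (rule linI[OF quot_vspace[OF D(1) W] quot_vspace[OF D(2) W']])
    fix c assume "c \<in> carrier (quot_space U W)"
    then obtain v where v: "v \<in> carrier U" "c = W +>\<^bsub>U\<^esub> v" unfolding QU(1) by blast
    show "set_add V W' (T ` c) \<in> carrier (quot_space V W')"
      unfolding v(2) ci[OF v(1)] QV(1) using D(3)[OF v(1)] by blast
    fix a
    show "set_add V W' (T ` (a \<odot>\<^bsub>quot_space U W\<^esub> c)) = a \<odot>\<^bsub>quot_space V W'\<^esub> set_add V W' (T ` c)"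
      unfolding v(2) QU(3)[OF v(1)] ci[OF v(1)] ci[OF vspace_simps(3)[OF D(1) v(1)]] QV(3)[OF D(3)[OF v(1)]] D(5)[OF v(1)] ..
  next
    fix c e assume "c \<in> carrier (quot_space U W)" "e \<in> carrier (quot_space U W)"
    then obtain u v where u: "u \<in> carrier U" "c = W +>\<^bsub>U\<^esub> u" and v: "v \<in> carrier U" "e = W +>\<^bsub>U\<^esub> v"
      unfolding QU(1) by blast
    show "set_add V W' (T ` (c \<oplus>\<^bsub>quot_space U W\<^esub> e)) =
        set_add V W' (T ` c) \<oplus>\<^bsub>quot_space V W'\<^esub> set_add V W' (T ` e)"
      unfolding u(2) v(2) QU(2)[OF u(1) v(1)] ci[OF u(1)] ci[OF v(1)] ci[OF vspace_simps(2)[OF D(1) u(1) v(1)]]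
        QV(2)[OF D(3)[OF u(1)] D(3)[OF v(1)]] D(4)[OF u(1) v(1)] ..
  qed
qed

text \<open>
The structure maps commute with the differentials, so they preserve cocycles and coboundaries and
induce linear maps on the quotients.
\<close>

theorem cohomology_is_rep:
  assumes X: "is_complex n X" shows "is_rep n (cohomology X i)"
proof -
  let ?sp = "\<lambda>i x. space_at (cobj X i) x"
  have fd: "fd_space (?sp i x)" if "x \<in> {1..n}" for i x
    using X that by (simp add: is_complex_def is_rep_def fd_space_def)
  have V: "vspace (?sp i x)" if "x \<in> {1..n}" for i x using fd[OF that] by (simp add: fd_space_def)
  have d: "lin (?sp i x) (?sp (i + 1) x) (cdiff X i x)" if "x \<in> {1..n}" for i x
    using X that by (simp add: is_complex_def rep_mor_def)
  have dd: "cdiff X (i + 1) x (cdiff X i x v) = \<zero>\<^bsub>?sp (i + 2) x\<^esub>" if "x \<in> {1..n}" "v \<in> carrier (?sp i x)" for i x v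
    using X that by (simp add: is_complex_def)
  have a: "lin (?sp i x) (?sp i (x + 1)) (arrow (cobj X i) x)" if "x \<in> {1..<n}" for i x
    using X that by (simp add: is_complex_def is_rep_def)
  have ad: "cdiff X i (x + 1) (arrow (cobj X i) x v) = arrow (cobj X (i + 1)) x (cdiff X i x v)"
    if "x \<in> {1..<n}" "v \<in> carrier (?sp i x)" for i x v
    using X that by (simp add: is_complex_def rep_mor_def)
  have Z: "subsp (?sp i x) (cocycles X i x)" if "x \<in> {1..n}" for x
    unfolding cocycles_def by (rule ker_subsp[OF d[OF that]])
  have d': "lin (?sp (i - 1) x) (?sp i x) (cdiff X (i - 1) x)" if "x \<in> {1..n}" for x
    using d[OF that, of "i - 1"] by simp
  have B: "subsp (?sp i x) (coboundaries X i x)" if "x \<in> {1..n}" for x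
    unfolding coboundaries_def by (rule image_subsp[OF d'[OF that] subsp_carrier[OF V[OF that]]])
  have BZ: "coboundaries X i x \<subseteq> cocycles X i x" if x: "x \<in> {1..n}" for x
  proof
    fix u assume u: "u \<in> coboundaries X i x"
    then obtain v where "v \<in> carrier (?sp (i - 1) x)" "u = cdiff X (i - 1) x v" by (auto simp: coboundaries_def)
    moreover have "i - 1 + 2 = i + 1" by simp
    ultimately have "cdiff X i x u = \<zero>\<^bsub>?sp (i + 1) x\<^esub>" using dd[OF x, of v "i - 1"] by (simp add: add.commute)
    thus "u \<in> cocycles X i x" using subspD(5)[OF B[OF x] u] by (simp add: cocycles_def)
  qed
  have BZ': "subsp (restr (?sp i x) (cocycles X i x)) (coboundaries X i x)" if "x \<in> {1..n}" for x
    by (rule subsp_trans[OF Z[OF that] B[OF that] BZ[OF that]])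
  have VZ: "fd_space (restr (?sp i x) (cocycles X i x))" if "x \<in> {1..n}" for x
    by (rule subsp_fin_dim[OF fd[OF that] Z[OF that]])
  have sp: "space_at (cohomology X i) x = quot_space (restr (?sp i x) (cocycles X i x)) (coboundaries X i x)" for x
    by (simp add: cohomology_def)
  show ?thesis unfolding is_rep_def
  proof (intro conjI ballI)
    fix x assume x: "x \<in> {1..n}"
    have "fd_space (space_at (cohomology X i) x)" unfolding sp
      by (rule quot_fd[OF _ BZ'[OF x] VZ[OF x]]) (use VZ[OF x] in \<open>simp add: fd_space_def\<close>)
    thus "vspace (space_at (cohomology X i) x)" "vectorspace.fin_dim class_ring (space_at (cohomology X i) x)"
      by (simp_all add: fd_space_def)
  next
    fix x assume x: "x \<in> {1..<n}"
    hence x0: "x \<in> {1..n}" and x1: "x + 1 \<in> {1..n}" by auto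
    let ?U = "restr (?sp i x) (cocycles X i x)" and ?V = "restr (?sp i (x + 1)) (cocycles X i (x + 1))"
    note A = linD[OF a[OF x]]
    have aZ: "arrow (cobj X i) x v \<in> cocycles X i (x + 1)" if v: "v \<in> cocycles X i x" for v
    proof -
      have vc: "v \<in> carrier (?sp i x)" and "cdiff X i x v = \<zero>\<^bsub>?sp (i + 1) x\<^esub>" using v by (auto simp: cocycles_def)
      hence "cdiff X i (x + 1) (arrow (cobj X i) x v) = \<zero>\<^bsub>?sp (i + 1) (x + 1)\<^esub>"
        using ad[OF x vc] A(6) linD(6)[OF a[OF x]] by simp
      thus ?thesis using A(3)[OF vc] by (simp add: cocycles_def)
    qed
    have "lin ?U ?V (arrow (cobj X i) x)"
      using A subspD(5)[OF Z[OF x0]] aZ VZ[OF x0] VZ[OF x1] by (intro linI) (simp_all add: fd_space_def)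
    moreover have "arrow (cobj X i) x ` coboundaries X i x \<subseteq> coboundaries X i (x + 1)"
    proof
      fix u assume "u \<in> arrow (cobj X i) x ` coboundaries X i x"
      then obtain v where v: "v \<in> carrier (?sp (i - 1) x)" "u = arrow (cobj X i) x (cdiff X (i - 1) x v)"
        by (auto simp: coboundaries_def)
      hence "u = cdiff X (i - 1) (x + 1) (arrow (cobj X (i - 1)) x v)" using ad[OF x v(1)] by simp
      thus "u \<in> coboundaries X i (x + 1)" unfolding coboundaries_def using linD(3)[OF a[OF x] v(1)] by blast
    qed
    ultimately have "lin (quot_space ?U (coboundaries X i x)) (quot_space ?V (coboundaries X i (x + 1)))
        (\<lambda>C. set_add ?V (coboundaries X i (x + 1)) (arrow (cobj X i) x ` C))"
      by (intro quot_induced_lin BZ'[OF x0] BZ'[OF x1])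
    moreover have "set_add ?V = set_add (?sp i (x + 1))" by (intro ext) (simp add: set_add_def')
    ultimately show "lin (space_at (cohomology X i) x) (space_at (cohomology X i) (x + 1)) (arrow (cohomology X i) x)"
      unfolding sp by (simp add: cohomology_def)
  qed
qed


section \<open>Barcodes and stability\<close>

lemma count_eq_card_copies: "count B J = card {j \<in> copies B. fst j = J}"
proof -
  have "{j \<in> copies B. fst j = J} = Pair J ` {..<count B J}" by (auto simp: copies_def)
  thus ?thesis by (simp add: card_image inj_on_def)
qed

text \<open>
The barcode is recovered from the rank function by inclusion-exclusion.
\<close>

lemma count_bars:
  "count B (Suc b, d) + (card (bars_over B b d) + card (bars_over B (Suc b) (Suc d))) =
    card (bars_over B (Suc b) d) + card (bars_over B b (Suc d))"
proof -
  have "{j \<in> copies B. birth j = Suc b \<and> d \<le> death j} =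
    {j \<in> copies B. fst j = (Suc b, d)} \<union> {j \<in> copies B. birth j = Suc b \<and> Suc d \<le> death j}"
    by (auto simp: prod_eq_iff)
  hence "card {j \<in> copies B. birth j = Suc b \<and> d \<le> death j} =
    card {j \<in> copies B. fst j = (Suc b, d)} + card {j \<in> copies B. birth j = Suc b \<and> Suc d \<le> death j}"
    by (simp only:) (rule card_Un_disjoint[OF finite_subset_copies finite_subset_copies], auto)
  thus ?thesis
    using card_bars_born[of B b d] card_bars_born[of B b "Suc d"] count_eq_card_copies[of B "(Suc b, d)"] by linarith
qed

text \<open>
The rank function depends on \<open>M\<close> alone and determines the multiplicities.
\<close>

lemma barcode_unique:
  assumes M: "persistence_module n M"
    and B: "valid_bars n B" "bar_coordinates M B l" and B': "valid_bars n B'" "bar_coordinates M B' l'"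
  shows "B = B'"
proof (rule multiset_eqI)
  fix J :: "nat \<times> nat"
  have eq: "card (bars_over B b d) = card (bars_over B' b d)" if "b \<le> d" for b d
    using dim_image_at[OF M B(2) that] dim_image_at[OF M B'(2) that] by simp
  obtain b d where J: "J = (b, d)" by (rule prod.exhaust)
  show "count B J = count B' J"
  proof (cases "1 \<le> b \<and> b \<le> d")
    case True
    then obtain c where c: "b = Suc c" "c \<le> d" "Suc c \<le> d" by (cases b) auto
    show ?thesis unfolding J c(1)
      using count_bars[of B c d] count_bars[of B' c d] eq[OF c(2)] eq[OF c(3)] eq[of c "Suc d"] eq[of "Suc c" "Suc d"] c
      by linarith
  next
    case False
    hence "J \<notin># B" "J \<notin># B'" using B(1) B'(1) J by auto
    thus ?thesis by (simp add: not_in_iff)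
  qed
qed

theorem barcode_correct:
  assumes M: "is_rep n M"
  shows "valid_bars n (barcode n M)" "\<exists>l. bar_coordinates (zero_extension n M) (barcode n M) l"
proof -
  let ?P = "\<lambda>B. valid_bars n B \<and> isomorphic_reps n M (interval_sum B)"
  note Z = zero_extension_persistence_module[OF M]
  have "\<exists>!B. ?P B"
  proof (rule ex_ex1I)
    obtain B l where "valid_bars n B" "bar_coordinates (zero_extension n M) B l"
      using exists_bar_coordinates[OF Z] by (elim exE conjE)
    thus "\<exists>B. ?P B" using bar_coordinates_imp_iso[OF M] by (intro exI[of _ B] conjI)
    show "B = B'" if P: "?P B" "?P B'" for B B'
    proof -
      have B: "valid_bars n B" "valid_bars n B'" using P by simp_all
      obtain l where l: "bar_coordinates (zero_extension n M) B l"
        using iso_imp_bar_coordinates[OF M B(1) conjunct2[OF P(1)]] ..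
      obtain l' where l': "bar_coordinates (zero_extension n M) B' l'"
        using iso_imp_bar_coordinates[OF M B(2) conjunct2[OF P(2)]] ..
      show ?thesis by (rule barcode_unique[OF Z B(1) l B(2) l'])
    qed
  qed
  hence P: "?P (barcode n M)" unfolding barcode_def by (rule theI')
  thus v: "valid_bars n (barcode n M)" by (rule conjunct1)
  show "\<exists>l. bar_coordinates (zero_extension n M) (barcode n M) l"
    by (rule iso_imp_bar_coordinates[OF M v conjunct2[OF P]])
qed

lemma path_map_in:
  "persistence_module n M \<Longrightarrow> v \<in> vecs M x \<Longrightarrow> path_map M x k v \<in> vecs M (x + k)"
  by (rule linD(3)[OF path_map_lin])

lemma path_map_zero_extension:
  assumes "1 \<le> x" "x + k \<le> n"
  shows "path_map (zero_extension n M) x k v = path_map M x k v"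
  using assms(2) by (induction k) (use assms(1) in \<open>simp_all add: zero_extension_inside\<close>)

text \<open>
A morphism \<open>M \<rightarrow> N(\<delta>)\<close> over the quiver, continued by zero to the extensions of \<open>M\<close> and \<open>N\<close>.
\<close>

definition extend_mor :: "nat \<Rightarrow> nat \<Rightarrow> ('k, 'w) rep \<Rightarrow> (nat \<Rightarrow> 'v \<Rightarrow> 'w) \<Rightarrow> nat \<Rightarrow> 'v \<Rightarrow> 'w" where
  "extend_mor n \<delta> N f x = (if 1 \<le> x \<and> x + \<delta> \<le> n then f x else (\<lambda>_. zero_at (zero_extension n N) (x + \<delta>)))"

lemma extend_mor_lin:
  assumes K: "is_rep n K" and L: "is_rep n L" and h: "rep_mor n K (shift n \<delta> L) h"
  shows "lin (space_at (zero_extension n K) x) (space_at (zero_extension n L) (x + \<delta>)) (extend_mor n \<delta> L h x)"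
proof (cases "1 \<le> x \<and> x + \<delta> \<le> n")
  case True
  hence "lin (space_at K x) (space_at (shift n \<delta> L) x) (h x)" using h by (simp add: rep_mor_def)
  thus ?thesis using True by (simp add: extend_mor_def zero_extension_inside shift_def)
next
  case False
  show ?thesis unfolding extend_mor_def if_not_P[OF False]
    by (rule zero_lin) (rule persistence_moduleD(2)[OF zero_extension_persistence_module] K L)+
qed

text \<open>
Continuation by zero respects all identities: an equation at \<open>x\<close> holds at \<open>x = 0\<close> since the source
is zero there, and when its target lies beyond \<open>n\<close> since the target is zero.
\<close>

lemma extend_half_interleaving:
  assumes M: "is_rep n M" and N: "is_rep n N"
    and f: "rep_mor n M (shift n \<delta> N) f" and g: "rep_mor n N (shift n \<delta> M) g"
    and gf: "\<forall>x\<in>{1..n}. \<forall>v\<in>vecs M x. shift_mor n \<delta> g x (f x v) = transition n (2 * \<delta>) M x v"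
  shows "half_interleaving \<delta> (zero_extension n M) (zero_extension n N)
    (extend_mor n \<delta> N f) (extend_mor n \<delta> M g)"
proof -
  let ?M = "zero_extension n M" and ?N = "zero_extension n N"
  let ?f = "extend_mor n \<delta> N f" and ?g = "extend_mor n \<delta> M g"
  note ZM = zero_extension_persistence_module[OF M] and ZN = zero_extension_persistence_module[OF N]
  note PM = persistence_moduleD[OF ZM] and PN = persistence_moduleD[OF ZN]
  have lf: "lin (space_at ?M x) (space_at ?N (x + \<delta>)) (?f x)" for x by (rule extend_mor_lin[OF M N f])
  have lg: "lin (space_at ?N x) (space_at ?M (x + \<delta>)) (?g x)" for x by (rule extend_mor_lin[OF N M g])
  have nat: "?f (Suc x) (arrow ?M x v) = arrow ?N (x + \<delta>) (?f x v)" if v: "v \<in> vecs ?M x" for x v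
  proof -
    have l: "?f (Suc x) (arrow ?M x v) \<in> vecs ?N (Suc (x + \<delta>))"
      using linD(3)[OF lf[of "Suc x"] linD(3)[OF PM(3) v]] by simp
    have r: "arrow ?N (x + \<delta>) (?f x v) \<in> vecs ?N (Suc (x + \<delta>))"
      by (rule linD(3)[OF PN(3) linD(3)[OF lf v]])
    consider "x = 0" | "n < Suc (x + \<delta>)" | "1 \<le> x" "Suc x + \<delta> \<le> n" by linarith
    thus ?thesis
    proof cases
      case 1
      hence "v = zero_at ?M x" using PM(4)[of x] v by simp
      thus ?thesis using linD(6)[OF PM(3)[of x]] linD(6)[OF lf] linD(6)[OF PN(3)] by simp
    next
      case 2
      thus ?thesis using PN(4)[of "Suc (x + \<delta>)"] l r by auto
    next
      case 3
      have "f (x + 1) (arrow M x v) = arrow (shift n \<delta> N) x (f x v)"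
        using f 3 v by (simp add: rep_mor_def zero_extension_inside)
      thus ?thesis using 3 by (simp add: extend_mor_def zero_extension_inside shift_def)
    qed
  qed
  have comp: "?g (x + \<delta>) (?f x v) = path_map ?M x (2 * \<delta>) v" if v: "v \<in> vecs ?M x" for x v
  proof -
    have l: "?g (x + \<delta>) (?f x v) \<in> vecs ?M (x + 2 * \<delta>)"
      using linD(3)[OF lg linD(3)[OF lf v]] by (simp add: mult_2 add.assoc)
    have r: "path_map ?M x (2 * \<delta>) v \<in> vecs ?M (x + 2 * \<delta>)" by (rule path_map_in[OF ZM v])
    consider "x = 0" | "n < x + 2 * \<delta>" | "1 \<le> x" "x + 2 * \<delta> \<le> n" by linarith
    thus ?thesis
    proof cases
      case 1
      hence "v = zero_at ?M x" using PM(4)[of x] v by simp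
      thus ?thesis
        using linD(6)[OF lf[of x]] linD(6)[OF lg[of "x + \<delta>"]] linD(6)[OF path_map_lin[OF ZM, of x "2 * \<delta>"]]
        by (simp add: mult_2 add.assoc)
    next
      case 2
      thus ?thesis using PM(4)[of "x + 2 * \<delta>"] l r by auto
    next
      case 3
      have "v \<in> vecs M x" using v 3 by (simp add: zero_extension_inside)
      hence "shift_mor n \<delta> g x (f x v) = transition n (2 * \<delta>) M x v" using gf 3 by simp
      thus ?thesis using 3
        by (simp add: extend_mor_def shift_mor_def transition_def path_map_zero_extension)
    qed
  qed
  show ?thesis unfolding half_interleaving_def using lf nat comp by blast
qed

text \<open>
The rank function of the image of \<open>f\<close> and the two barcodes satisfy the inequalities of
\<open>bar_counts\<close>, because ranks in \<open>M\<close> and \<open>N\<close> are bar counts.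
\<close>

theorem algebraic_stability:
  assumes M: "is_rep n M" and N: "is_rep n N" and fg: "interleaving_pair n \<delta> M N f g"
  shows "\<exists>S S' \<sigma>. delta_matching \<delta> (barcode n M) (barcode n N) S S' \<sigma>"
proof -
  let ?M = "zero_extension n M" and ?N = "zero_extension n N"
  interpret I: interleaved n \<delta> ?M ?N "extend_mor n \<delta> N f" "extend_mor n \<delta> M g"
    using fg unfolding interleaving_pair_def
    by unfold_locales
      (auto intro!: zero_extension_persistence_module M N extend_half_interleaving)
  obtain l where l: "bar_coordinates ?M (barcode n M) l" using barcode_correct(2)[OF M] by blast
  obtain l' where l': "bar_coordinates ?N (barcode n N) l'" using barcode_correct(2)[OF N] by blast
  note rM = dim_image_at[OF I.M l] and rN = dim_image_at[OF I.N l']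
  interpret bar_counts n \<delta> "barcode n M" "barcode n N" I.rI
  proof
    show "valid_bars n (barcode n M)" "valid_bars n (barcode n N)"
      by (rule barcode_correct(1)[OF M], rule barcode_correct(1)[OF N])
    fix b c d
    show "I.rI (Suc b) d + card (bars_over (barcode n M) b d) \<le> card (bars_over (barcode n M) (Suc b) d) + I.rI b d"
      if "Suc b \<le> d" using I.rank_epi[of b "Suc b" d] rM[of b d] rM[of "Suc b" d] that by simp
    show "card (bars_over (barcode n M) (Suc b) (d + 2 * \<delta>)) + I.rI b d \<le>
        I.rI (Suc b) d + card (bars_over (barcode n M) b (d + 2 * \<delta>))"
      if "Suc b \<le> d" using I.rank_epi'[of b "Suc b" d] rM[of b "d + 2 * \<delta>"] rM[of "Suc b" "d + 2 * \<delta>"] that by simp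
    show "I.rI b d + card (bars_over (barcode n N) (b + \<delta>) (Suc (d + \<delta>))) \<le>
        card (bars_over (barcode n N) (b + \<delta>) (d + \<delta>)) + I.rI b (Suc d)"
      if "b \<le> d" using I.rank_mono[OF that] rN[of "b + \<delta>" "Suc (d + \<delta>)"] rN[of "b + \<delta>" "d + \<delta>"] that by simp
    show "card (bars_over (barcode n N) c (d + \<delta>)) + I.rI (c + \<delta>) (Suc d) \<le>
        I.rI (c + \<delta>) d + card (bars_over (barcode n N) c (Suc (d + \<delta>)))"
      if "c + \<delta> \<le> d" using I.rank_mono'[OF that] rN[of c "Suc (d + \<delta>)"] rN[of c "d + \<delta>"] that by simp
    show "I.rI b d + I.rI (Suc b) (Suc d) \<le> I.rI (Suc b) d + I.rI b (Suc d)"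
      if "Suc b \<le> d" using I.rank_convex[of b "Suc b" d] that by simp
    show "I.rI b d = 0" if "b \<le> d" "b = 0 \<or> n < d" by (rule I.rI_trivial[OF that])
  qed
  show ?thesis by (rule exists_delta_matching)
qed

theorem theorem4p1:
  fixes n :: nat
    and X :: "('k::alg_closed_field, 'v) cpx"
    and Y :: "('k, 'w) cpx"
  assumes "n \<ge> 1"
    and "bounded_complex n X"
    and "bounded_complex n Y"
  shows "derived_bottleneck_dist (derived_barcode n X) (derived_barcode n Y)
           \<le> derived_interleaving_dist n X Y"
proof -
  have coh: "is_rep n (cohomology X i)" "is_rep n (cohomology Y i)" for i
    using cohomology_is_rep assms(2,3) unfolding bounded_complex_def by blast+
  have "derived_matched \<delta> (derived_barcode n X) (derived_barcode n Y)"
    if "derived_interleaved n \<delta> X Y" for \<delta>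
    unfolding derived_matched_def derived_barcode_def
  proof
    fix i
    from that obtain f g where "interleaving_pair n \<delta> (cohomology X i) (cohomology Y i) f g"
      unfolding derived_interleaved_def by blast
    thus "\<exists>S S' \<sigma>. delta_matching \<delta> (barcode n (cohomology X i)) (barcode n (cohomology Y i)) S S' \<sigma>"
      by (rule algebraic_stability[OF coh])
  qed
  hence "{\<delta>. derived_interleaved n \<delta> X Y} \<subseteq> {\<delta>. derived_matched \<delta> (derived_barcode n X) (derived_barcode n Y)}"
    by blast
  thus ?thesis unfolding derived_bottleneck_dist_def derived_interleaving_dist_def
    by (intro INF_superset_mono) auto
qed

end
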